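(* Let $\omega\in\mathbb C$. (i) If $\omega=-1$, then every finite-dimensional irreducible $\mathfrak K_\omega$-module $V$ is one-dimensional and there is $\mu\in\mathbb C$ with $Av=\mu v$ and $Bv=\mu v$ for all $v\in V$. (ii) If $\omega=1$, then every finite-dimensional irreducible $\mathfrak K_\omega$-module $V$ is one-dimensional and there is $\mu\in\mathbb C$ with $Av=\mu v$ and $Bv=-\mu v$ for all $v\in V$. (iii) If $\omega^2\neq1$, then for every integer $n\geq 0$, $L_n$ is, up to isomorphism, the unique $(n+1)$-dimensional irreducible $\mathfrak K_\omega$-module.
   Context: All algebras are unital associative over $\mathbb C$. $\mathrm U(\mathfrak{sl}_2)$ is the algebra generated by $E,F,H$ with $[H,E]=2E$, $[H,F]=-2F$, $[E,F]=H$. For $\omega\in\mathbb C$, $\mathfrak K_\omega$ is the algebra generated by $A,B$ subject to $A^2B-2ABA+BA^2=B+\omega A$ and $B^2A-2BAB+AB^2=A+\omega B$. There is an algebra homomorphism $\zeta\colon\mathfrak K_\omega\to\mathrm U(\mathfrak{sl}_2)$ with $A\mapsto \frac{1+\omega}{2}E+\frac{1-\omega}{2}F-\frac{\omega}{2}H$, $B\mapsto \frac12H$. For $n\ge0$, $L_n$ is the $(n+1)$-dimensional $\mathrm U(\mathfrak{sl}_2)$-module with basis $v_0,\dots,v_n$ where $Ev_i=(n-i+1)v_{i-1}$ ($1\le i\le n$), $Ev_0=0$, $Fv_i=(i+1)v_{i+1}$ ($0\le i\le n-1$), $Fv_n=0$, $Hv_i=(n-2i)v_i$; it is regarded as a $\mathfrak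 K_\omega$-module by pulling back via $\zeta$. *)

theory Defs
  imports Complex_Main "HOL-Library.Poly_Mapping" "HOL-Algebra.QuotRing"
begin

section \<open>Unital associative algebras over the complex numbers\<close>

text \<open>
  The algebras below are quotients of free algebras by ideals depending on a parameter, so they
  are records with a carrier. Modules over them live on a linear subspace of an ambient
  complex vector space, because \<open>L\<^sub>n\<close> needs a carrier depending on \<open>n\<close>.
\<close>

record 'a calg = "'a ring" +
  cscale :: "[complex, 'a] \<Rightarrow> 'a" (infixl \<open>\<odot>\<index>\<close> 70)

locale complex_algebra = ring A for A :: "'a calg" (structure) +
  assumes cscale_closed: "x \<in> carrier A \<Longrightarrow> c \<odot> x \<in> carrier A"
    and cscale_add_left: "x \<in> carrier A \<Longrightarrow> (c + d) \<odot> x = (c \<odot> x) \<oplus> (d \<odot> x)"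
    and cscale_add_right:
      "\<lbrakk>x \<in> carrier A; y \<in> carrier A\<rbrakk> \<Longrightarrow> c \<odot> (x \<oplus> y) = (c \<odot> x) \<oplus> (c \<odot> y)"
    and cscale_assoc: "x \<in> carrier A \<Longrightarrow> (c * d) \<odot> x = c \<odot> (d \<odot> x)"
    and cscale_one: "x \<in> carrier A \<Longrightarrow> 1 \<odot> x = x"
    and cscale_mult_left:
      "\<lbrakk>x \<in> carrier A; y \<in> carrier A\<rbrakk> \<Longrightarrow> (c \<odot> x) \<otimes> y = c \<odot> (x \<otimes> y)"
    and cscale_mult_right:
      "\<lbrakk>x \<in> carrier A; y \<in> carrier A\<rbrakk> \<Longrightarrow> x \<otimes> (c \<odot> y) = c \<odot> (x \<otimes> y)"

definition calg_hom :: "'a calg \<Rightarrow> 'b calg \<Rightarrow> ('a \<Rightarrow> 'b) set" where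
  "calg_hom A B = {f \<in> ring_hom A B. \<forall>c. \<forall>x\<in>carrier A. f (c \<odot>\<^bsub>A\<^esub> x) = c \<odot>\<^bsub>B\<^esub> f x}"


section \<open>Modules\<close>

locale calg_module = vector_space scl
  for scl :: "complex \<Rightarrow> 'v::ab_group_add \<Rightarrow> 'v" +
  fixes A :: "'a calg" (structure) and V :: "'v set" and act :: "'a \<Rightarrow> 'v \<Rightarrow> 'v"
  assumes subspace_V: "subspace V"
    and act_closed: "\<lbrakk>x \<in> carrier A; v \<in> V\<rbrakk> \<Longrightarrow> act x v \<in> V"
    and act_add: "\<lbrakk>x \<in> carrier A; v \<in> V; w \<in> V\<rbrakk> \<Longrightarrow> act x (v + w) = act x v + act x w"
    and act_scl: "\<lbrakk>x \<in> carrier A; v \<in> V\<rbrakk> \<Longrightarrow> act x (scl c v) = scl c (act x v)"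
    and add_act:
      "\<lbrakk>x \<in> carrier A; y \<in> carrier A; v \<in> V\<rbrakk> \<Longrightarrow> act (x \<oplus> y) v = act x v + act y v"
    and cscale_act: "\<lbrakk>x \<in> carrier A; v \<in> V\<rbrakk> \<Longrightarrow> act (c \<odot> x) v = scl c (act x v)"
    and mult_act:
      "\<lbrakk>x \<in> carrier A; y \<in> carrier A; v \<in> V\<rbrakk> \<Longrightarrow> act (x \<otimes> y) v = act x (act y v)"
    and one_act: "v \<in> V \<Longrightarrow> act \<one> v = v"
begin

definition submodule :: "'v set \<Rightarrow> bool" where
  "submodule W \<longleftrightarrow> subspace W \<and> W \<subseteq> V \<and> (\<forall>x\<in>carrier A. \<forall>w\<in>W. act x w \<in> W)"

definition irreducible_module :: bool where
  "irreducible_module \<longleftrightarrow> V \<noteq> {0} \<and> (\<forall>W. submodule W \<longrightarrow> W = {0} \<or> W = V)"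

definition finite_dimensional_module :: bool where
  "finite_dimensional_module \<longleftrightarrow> (\<exists>S. finite S \<and> S \<subseteq> V \<and> span S = V)"

end

text \<open>
  The locale predicates are collected here. For \<open>fd_irr_module\<close> it matters that the library's \<open>dim\<close>
  is \<open>0\<close> on infinite-dimensional spaces, so finite-dimensionality is stated separately.
\<close>

definition fd_irr_module ::
    "'a calg \<Rightarrow> (complex \<Rightarrow> 'v::ab_group_add \<Rightarrow> 'v) \<Rightarrow> 'v set \<Rightarrow> ('a \<Rightarrow> 'v \<Rightarrow> 'v) \<Rightarrow> bool" where
  "fd_irr_module A scl V act \<longleftrightarrow>
     calg_module scl A V act \<and> calg_module.finite_dimensional_module scl V \<and>
     calg_module.irreducible_module scl A V act"

definition module_iso ::
    "'a calg \<Rightarrow> (complex \<Rightarrow> 'v::ab_group_add \<Rightarrow> 'v) \<Rightarrow> 'v set \<Rightarrow> ('a \<Rightarrow> 'v \<Rightarrow> 'v) \<Rightarrow>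
     (complex \<Rightarrow> 'w::ab_group_add \<Rightarrow> 'w) \<Rightarrow> 'w set \<Rightarrow> ('a \<Rightarrow> 'w \<Rightarrow> 'w) \<Rightarrow> ('v \<Rightarrow> 'w) \<Rightarrow> bool" where
  "module_iso A scl V act scl' W act' f \<longleftrightarrow>
     bij_betw f V W \<and>
     (\<forall>v\<in>V. \<forall>w\<in>V. f (v + w) = f v + f w) \<and>
     (\<forall>c. \<forall>v\<in>V. f (scl c v) = scl' c (f v)) \<and>
     (\<forall>x\<in>carrier A. \<forall>v\<in>V. f (act x v) = act' x (f v))"


section \<open>Algebras given by generators and relations\<close>

text \<open>
  The free algebra on \<open>'g\<close> is the monoid algebra of the free monoid of words. The wrapper type
  is needed because lists carry no \<open>monoid_add\<close> instance, on which the convolution product of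
  finitely supported functions is based.
\<close>

datatype 'g word = Word (letters: "'g list")

instantiation word :: (type) monoid_add
begin

definition zero_word :: "'a word" where "zero_word = Word []"

definition plus_word :: "'a word \<Rightarrow> 'a word \<Rightarrow> 'a word" where
  "plus_word u w = Word (letters u @ letters w)"

instance
  by standard (simp_all add: zero_word_def plus_word_def)

end

type_synonym 'g free_algebra = "'g word \<Rightarrow>\<^sub>0 complex"

definition fconst :: "complex \<Rightarrow> 'g free_algebra" where
  "fconst c = Poly_Mapping.single 0 c"

definition fgen :: "'g \<Rightarrow> 'g free_algebra" where
  "fgen g = Poly_Mapping.single (Word [g]) 1"

definition free_ring :: "'g free_algebra ring" where
  "free_ring = \<lparr>carrier = UNIV, mult = (*), one = 1, zero = 0, add = (+)\<rparr>"

text \<open>\<open>R\<close> is the set of those elements of the free algebra that are to become zero.\<close>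

definition pres_coset :: "'g free_algebra set \<Rightarrow> 'g free_algebra \<Rightarrow> 'g free_algebra set" where
  "pres_coset R p = (Idl\<^bsub>free_ring\<^esub> R) +>\<^bsub>free_ring\<^esub> p"

definition pres_gen :: "'g free_algebra set \<Rightarrow> 'g \<Rightarrow> 'g free_algebra set" where
  "pres_gen R g = pres_coset R (fgen g)"

definition presented_algebra :: "'g free_algebra set \<Rightarrow> 'g free_algebra set calg" where
  "presented_algebra R =
    (let Q = free_ring Quot (Idl\<^bsub>free_ring\<^esub> R) in
     \<lparr>carrier = carrier Q, mult = mult Q, one = one Q, zero = zero Q, add = add Q,
      cscale = (\<lambda>c X. pres_coset R (fconst c) \<otimes>\<^bsub>Q\<^esub> X)\<rparr>)"

text \<open>
  The two following maps send an element of the free algebra to the endomorphism, respectively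
  to the element of another free algebra, that it becomes when the generators are replaced.
\<close>

definition free_act ::
    "(complex \<Rightarrow> 'v \<Rightarrow> 'v) \<Rightarrow> ('g \<Rightarrow> 'v \<Rightarrow> 'v) \<Rightarrow> 'g free_algebra \<Rightarrow> 'v \<Rightarrow> 'v::ab_group_add" where
  "free_act scl T p v =
     (\<Sum>w\<in>Poly_Mapping.keys p. scl (Poly_Mapping.lookup p w) (foldr T (letters w) v))"

definition free_subst :: "('g \<Rightarrow> 'h free_algebra) \<Rightarrow> 'g free_algebra \<Rightarrow> 'h free_algebra" where
  "free_subst s p =
     (\<Sum>w\<in>Poly_Mapping.keys p.
        fconst (Poly_Mapping.lookup p w) * prod_list (map s (letters w)))"


section \<open>The algebras and the homomorphism between them\<close>

datatype sl2_gen = gE | gF | gH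

definition sl2_rels :: "sl2_gen free_algebra set" where
  "sl2_rels =
    (let E = fgen gE; F = fgen gF; H = fgen gH in
     {H * E - E * H - 2 * E,
      H * F - F * H + 2 * F,
      E * F - F * E - H})"

definition U_sl2 :: "sl2_gen free_algebra set calg" where
  "U_sl2 = presented_algebra sl2_rels"

datatype K_gen = gA | gB

definition K_rels :: "complex \<Rightarrow> K_gen free_algebra set" where
  "K_rels \<omega> =
    (let A = fgen gA; B = fgen gB in
     {(A^2 * B - 2 * A * B * A + B * A^2) - (B + fconst \<omega> * A),
      (B^2 * A - 2 * B * A * B + A * B^2) - (A + fconst \<omega> * B)})"

definition K_alg :: "complex \<Rightarrow> K_gen free_algebra set calg" where
  "K_alg \<omega> = presented_algebra (K_rels \<omega>)"

abbreviation K_A :: "complex \<Rightarrow> K_gen free_algebra set" where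
  "K_A \<omega> \<equiv> pres_gen (K_rels \<omega>) gA"

abbreviation K_B :: "complex \<Rightarrow> K_gen free_algebra set" where
  "K_B \<omega> \<equiv> pres_gen (K_rels \<omega>) gB"

fun zeta_gen :: "complex \<Rightarrow> K_gen \<Rightarrow> sl2_gen free_algebra" where
  "zeta_gen \<omega> gA =
     fconst ((1 + \<omega>) / 2) * fgen gE + fconst ((1 - \<omega>) / 2) * fgen gF - fconst (\<omega> / 2) * fgen gH"
| "zeta_gen \<omega> gB = fconst (1 / 2) * fgen gH"

text \<open>
  All representatives of a coset \<open>X\<close> have the same value (see the lemma \<open>zeta_pres_coset\<close>
  below), which is the element picked out by \<open>the_elem\<close>.
\<close>

definition zeta :: "complex \<Rightarrow> K_gen free_algebra set \<Rightarrow> sl2_gen free_algebra set" where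
  "zeta \<omega> X = the_elem ((\<lambda>p. pres_coset sl2_rels (free_subst (zeta_gen \<omega>) p)) ` X)"


section \<open>The modules \<open>L\<^sub>n\<close>\<close>

text \<open>
  The ambient space of all \<open>L\<^sub>n\<close> has basis \<open>Lvec 0, Lvec 1, \<dots>\<close>, and \<open>E\<close>, \<open>F\<close>, \<open>H\<close> are extended
  by zero to the basis vectors beyond \<open>Lvec n\<close>.
\<close>

definition Lscale :: "complex \<Rightarrow> (nat \<Rightarrow>\<^sub>0 complex) \<Rightarrow> (nat \<Rightarrow>\<^sub>0 complex)" where
  "Lscale c v = Poly_Mapping.map ((*) c) v"

definition Lvec :: "nat \<Rightarrow> (nat \<Rightarrow>\<^sub>0 complex)" where
  "Lvec i = Poly_Mapping.single i 1"

definition L_space :: "nat \<Rightarrow> (nat \<Rightarrow>\<^sub>0 complex) set" where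
  "L_space n = module.span Lscale (Lvec ` {0..n})"

fun L_basis_op :: "nat \<Rightarrow> sl2_gen \<Rightarrow> nat \<Rightarrow> (nat \<Rightarrow>\<^sub>0 complex)" where
  "L_basis_op n gE i = (if 1 \<le> i \<and> i \<le> n then Lscale (of_nat (n - i + 1)) (Lvec (i - 1)) else 0)"
| "L_basis_op n gF i = (if i < n then Lscale (of_nat (i + 1)) (Lvec (i + 1)) else 0)"
| "L_basis_op n gH i = (if i \<le> n then Lscale (of_nat n - 2 * of_nat i) (Lvec i) else 0)"

definition L_op :: "nat \<Rightarrow> sl2_gen \<Rightarrow> (nat \<Rightarrow>\<^sub>0 complex) \<Rightarrow> (nat \<Rightarrow>\<^sub>0 complex)" where
  "L_op n g v =
     (\<Sum>i\<in>Poly_Mapping.keys v. Lscale (Poly_Mapping.lookup v i) (L_basis_op n g i))"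

definition L_act :: "nat \<Rightarrow> sl2_gen free_algebra set \<Rightarrow> (nat \<Rightarrow>\<^sub>0 complex) \<Rightarrow> (nat \<Rightarrow>\<^sub>0 complex)" where
  "L_act n X v = the_elem ((\<lambda>p. free_act Lscale (L_op n) p v) ` X)"

definition LK_act ::
    "complex \<Rightarrow> nat \<Rightarrow> K_gen free_algebra set \<Rightarrow> (nat \<Rightarrow>\<^sub>0 complex) \<Rightarrow> (nat \<Rightarrow>\<^sub>0 complex)" where
  "LK_act \<omega> n X = L_act n (zeta \<omega> X)"


section \<open>The definitions are well-formed\<close>

lemma ring_free_ring: "ring free_ring"
proof -
  have "abelian_group (free_ring :: 'g free_algebra ring)"
    by (rule abelian_groupI)
      (auto simp: free_ring_def algebra_simps intro: exI[of _ "- x" for x] left_minus)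
  moreover have "Group.monoid (free_ring :: 'g free_algebra ring)"
    by (rule monoidI) (auto simp: free_ring_def algebra_simps)
  ultimately show ?thesis
    by (rule ringI) (auto simp: free_ring_def algebra_simps)
qed

lemma free_ring_simps [simp]:
  "carrier free_ring = UNIV" "x \<otimes>\<^bsub>free_ring\<^esub> y = x * y" "x \<oplus>\<^bsub>free_ring\<^esub> y = x + y"
  "\<one>\<^bsub>free_ring\<^esub> = 1" "\<zero>\<^bsub>free_ring\<^esub> = 0"
  by (simp_all add: free_ring_def)

lemma ideal_rels: "ideal (Idl\<^bsub>free_ring\<^esub> R) free_ring"
  by (rule ring.genideal_ideal[OF ring_free_ring]) simp

lemma rels_subset: "R \<subseteq> Idl\<^bsub>free_ring\<^esub> R"
  by (rule ring.genideal_self[OF ring_free_ring]) simp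

lemma the_elem_image:
  assumes "x \<in> X" "\<And>y. y \<in> X \<Longrightarrow> f y = f x"
  shows "the_elem (f ` X) = f x"
proof -
  have "f ` X = {f x}" using assms by (metis image_is_empty empty_iff image_subsetI singletonI subset_singletonD)
  then show ?thesis by simp
qed

lemma rels_ideal_closed:
  "0 \<in> Idl\<^bsub>free_ring\<^esub> R"
  "\<lbrakk>x \<in> Idl\<^bsub>free_ring\<^esub> R; y \<in> Idl\<^bsub>free_ring\<^esub> R\<rbrakk> \<Longrightarrow> x + y \<in> Idl\<^bsub>free_ring\<^esub> R"
  "\<lbrakk>x \<in> Idl\<^bsub>free_ring\<^esub> R; y \<in> Idl\<^bsub>free_ring\<^esub> R\<rbrakk> \<Longrightarrow> x - y \<in> Idl\<^bsub>free_ring\<^esub> R"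
  "x \<in> Idl\<^bsub>free_ring\<^esub> R \<Longrightarrow> z * x \<in> Idl\<^bsub>free_ring\<^esub> R"
  "x \<in> Idl\<^bsub>free_ring\<^esub> R \<Longrightarrow> x * z \<in> Idl\<^bsub>free_ring\<^esub> R"
proof -
  let ?I = "Idl\<^bsub>free_ring\<^esub> R"
  note id = ideal_rels[of R]
  note sub = ideal.axioms(1)[OF id]
  show "0 \<in> ?I" using additive_subgroup.zero_closed[OF sub] by simp
  show add: "x + y \<in> ?I" if "x \<in> ?I" "y \<in> ?I" for x y
    using additive_subgroup.a_closed[OF sub that] by simp
  show l: "z * x \<in> ?I" if "x \<in> ?I" for x z
    using ideal.I_l_closed[OF id that, of z] by simp
  show "x * z \<in> ?I" if "x \<in> ?I"
    using ideal.I_r_closed[OF id that, of z] by simp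
  show "x - y \<in> ?I" if "x \<in> ?I" "y \<in> ?I"
    using add[OF that(1) l[OF that(2), of "-1"]] by simp
qed

lemma genideal_free_ring_subset:
  assumes "R \<subseteq> J" "0 \<in> J" "\<And>a b. \<lbrakk>a \<in> J; b \<in> J\<rbrakk> \<Longrightarrow> a - b \<in> J"
    "\<And>a x. a \<in> J \<Longrightarrow> x * a \<in> J" "\<And>a x. a \<in> J \<Longrightarrow> a * x \<in> J"
  shows "Idl\<^bsub>free_ring\<^esub> R \<subseteq> J"
proof (rule ring.genideal_minimal[OF ring_free_ring _ assms(1)])
  have minus: "- a \<in> J" if "a \<in> J" for a
    using assms(3)[OF assms(2) that] by simp
  have "subgroup J (add_monoid free_ring)"
  proof (rule group.subgroupI)
    show "group (add_monoid (free_ring :: 'a free_algebra ring))"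
      using ring_free_ring by (meson abelian_group.a_group ring_def)
    show "inv\<^bsub>add_monoid free_ring\<^esub> a \<in> J" if "a \<in> J" for a
    proof -
      have "inv\<^bsub>add_monoid free_ring\<^esub> a = - a"
        by (rule group.inv_equality[OF \<open>group (add_monoid (free_ring :: 'a free_algebra ring))\<close>]) auto
      then show ?thesis using minus[OF that] by simp
    qed
    show "a \<otimes>\<^bsub>add_monoid free_ring\<^esub> b \<in> J" if "a \<in> J" "b \<in> J" for a b
      using assms(3)[OF that(1) minus[OF that(2)]] by simp
  qed (use assms(2) in auto)
  then show "ideal J free_ring"
    by (rule idealI[OF ring_free_ring]) (use assms in auto)
qed

lemma pres_coset_iff: "q \<in> pres_coset R p \<longleftrightarrow> q - p \<in> Idl\<^bsub>free_ring\<^esub> R"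
proof -
  have "q \<in> pres_coset R p \<longleftrightarrow> (\<exists>h\<in>Idl\<^bsub>free_ring\<^esub> R. q = h + p)"
    by (auto simp: pres_coset_def a_r_coset_def')
  then show ?thesis
    by (metis add_diff_cancel diff_add_cancel)
qed

lemma pres_coset_self: "p \<in> pres_coset R p"
  by (simp add: pres_coset_iff rels_ideal_closed)

lemma pres_coset_eq_iff: "pres_coset R p = pres_coset R q \<longleftrightarrow> p - q \<in> Idl\<^bsub>free_ring\<^esub> R"
proof
  show "p - q \<in> Idl\<^bsub>free_ring\<^esub> R" if "pres_coset R p = pres_coset R q"
    using pres_coset_self[of p R] that by (simp add: pres_coset_iff)
next
  assume a: "p - q \<in> Idl\<^bsub>free_ring\<^esub> R"
  show "pres_coset R p = pres_coset R q"
  proof (intro subset_antisym subsetI)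
    fix x
    show "x \<in> pres_coset R q" if "x \<in> pres_coset R p"
      using rels_ideal_closed(2)[OF that[unfolded pres_coset_iff] a] by (simp add: pres_coset_iff)
    show "x \<in> pres_coset R p" if "x \<in> pres_coset R q"
      using rels_ideal_closed(3)[OF that[unfolded pres_coset_iff] a] by (simp add: pres_coset_iff)
  qed
qed

lemma pres_carrier: "carrier (presented_algebra R) = range (pres_coset R)"
  by (auto simp: presented_algebra_def FactRing_def A_RCOSETS_def' pres_coset_def)

lemma pres_ops:
  "pres_coset R p \<otimes>\<^bsub>presented_algebra R\<^esub> pres_coset R q = pres_coset R (p * q)"
  "pres_coset R p \<oplus>\<^bsub>presented_algebra R\<^esub> pres_coset R q = pres_coset R (p + q)"
  "\<one>\<^bsub>presented_algebra R\<^esub> = pres_coset R 1"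
  "\<zero>\<^bsub>presented_algebra R\<^esub> = pres_coset R 0"
  "c \<odot>\<^bsub>presented_algebra R\<^esub> pres_coset R q = pres_coset R (fconst c * q)"
proof -
  interpret ideal "Idl\<^bsub>free_ring\<^esub> R" free_ring by (rule ideal_rels)
  show "pres_coset R p \<otimes>\<^bsub>presented_algebra R\<^esub> pres_coset R q = pres_coset R (p * q)"
    "c \<odot>\<^bsub>presented_algebra R\<^esub> pres_coset R q = pres_coset R (fconst c * q)"
    by (simp_all add: presented_algebra_def FactRing_def pres_coset_def rcoset_mult_add)
  show "pres_coset R p \<oplus>\<^bsub>presented_algebra R\<^esub> pres_coset R q = pres_coset R (p + q)"
    by (simp add: presented_algebra_def FactRing_def pres_coset_def a_rcos_sum)
  show "\<zero>\<^bsub>presented_algebra R\<^esub> = pres_coset R 0"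
    by (auto simp: presented_algebra_def FactRing_def pres_coset_iff)
  show "\<one>\<^bsub>presented_algebra R\<^esub> = pres_coset R 1"
    by (simp add: presented_algebra_def FactRing_def pres_coset_def)
qed

lemma fconst_simps:
  "fconst (c + d) = fconst c + fconst d" "fconst (c - d) = fconst c - fconst d"
  "fconst (- c) = - fconst c" "fconst (c * d) = fconst c * fconst d"
  "fconst 1 = 1" "fconst 0 = 0" "fconst (numeral k) = numeral k"
  by (simp_all add: fconst_def single_add single_diff single_uminus mult_single)

lemma poly_mapping_single_induct [case_names single add]:
  fixes p :: "'a \<Rightarrow>\<^sub>0 'b::comm_monoid_add"
  assumes "\<And>w c. P (Poly_Mapping.single w c)" "\<And>p q. \<lbrakk>P p; P q\<rbrakk> \<Longrightarrow> P (p + q)"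
  shows "P p"
proof -
  have "P (\<Sum>w\<in>S. Poly_Mapping.single w (Poly_Mapping.lookup p w))" if "finite S" for S
    using that
  proof (induction S rule: finite_induct)
    case empty
    show ?case using assms(1)[of undefined 0] by simp
  next
    case (insert x S)
    then show ?case using assms by simp
  qed
  moreover have "p = (\<Sum>w\<in>Poly_Mapping.keys p. Poly_Mapping.single w (Poly_Mapping.lookup p w))"
    by (rule poly_mapping_eqI)
      (simp add: lookup_sum lookup_single when_def sum.delta not_in_keys_iff_lookup_eq_zero)
  ultimately show ?thesis by (metis finite_keys)
qed

lemma fconst_commute: "fconst c * p = p * fconst c"
proof (induction p rule: poly_mapping_single_induct)
  case (single w d)
  show ?case by (simp add: fconst_def mult_single mult.commute)
qed (simp add: algebra_simps)

lemma complex_algebra_presented: "complex_algebra (presented_algebra R)"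
proof -
  let ?A = "presented_algebra R"
  have "ring ?A"
  proof (rule ringI)
    show "abelian_group ?A"
    proof (rule abelian_groupI)
      show "\<exists>y\<in>carrier ?A. y \<oplus>\<^bsub>?A\<^esub> x = \<zero>\<^bsub>?A\<^esub>" if x: "x \<in> carrier ?A" for x
      proof -
        from x obtain p where p: "x = pres_coset R p" by (auto simp: pres_carrier)
        then show ?thesis
          by (intro bexI[of _ "pres_coset R (- p)"]) (auto simp: pres_carrier pres_ops)
      qed
    qed (auto simp: pres_carrier pres_ops algebra_simps)
    show "Group.monoid ?A"
      by (rule monoidI) (auto simp: pres_carrier pres_ops algebra_simps)
  qed (auto simp: pres_carrier pres_ops algebra_simps)
  moreover have "p * (fconst c * q) = fconst c * (p * q)" for p q :: "'a free_algebra" and c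
    by (metis fconst_commute mult.assoc)
  then have "x \<otimes>\<^bsub>?A\<^esub> (c \<odot>\<^bsub>?A\<^esub> y) = c \<odot>\<^bsub>?A\<^esub> (x \<otimes>\<^bsub>?A\<^esub> y)"
    if "x \<in> carrier ?A" "y \<in> carrier ?A" for x y c
    using that by (auto simp only: pres_carrier pres_ops)
  ultimately show ?thesis
    by (intro complex_algebra.intro complex_algebra_axioms.intro)
      (auto simp: pres_carrier pres_ops fconst_simps distrib_left distrib_right mult.assoc)
qed

locale free_eval = vector_space scl
  for scl :: "complex \<Rightarrow> 'v::ab_group_add \<Rightarrow> 'v" +
  fixes T :: "'g \<Rightarrow> 'v \<Rightarrow> 'v"
  assumes T_add: "T g (v + w) = T g v + T g w" and T_scl: "T g (scl c v) = scl c (T g v)"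
begin

abbreviation "ev \<equiv> free_act scl T"

lemma foldr_add: "foldr T l (v + w) = foldr T l v + foldr T l w"
  by (induction l) (simp_all add: T_add)

lemma foldr_scl: "foldr T l (scl c v) = scl c (foldr T l v)"
  by (induction l) (simp_all add: T_scl)

lemma ev_superset:
  assumes "finite S" "Poly_Mapping.keys p \<subseteq> S"
  shows "ev p v = (\<Sum>w\<in>S. scl (Poly_Mapping.lookup p w) (foldr T (letters w) v))"
  unfolding free_act_def using assms
  by (intro sum.mono_neutral_left) (auto simp: in_keys_iff)

lemma ev_single: "ev (Poly_Mapping.single w c) v = scl c (foldr T (letters w) v)"
  by (subst ev_superset[of "{w}"]) auto

lemma ev_add: "ev (p + q) v = ev p v + ev q v"
proof -
  let ?S = "Poly_Mapping.keys p \<union> Poly_Mapping.keys q"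
  have "Poly_Mapping.keys (p + q) \<subseteq> ?S" by (rule keys_add)
  then show ?thesis
    by (simp add: ev_superset[of ?S] lookup_add scale_left_distrib sum.distrib)
qed

lemma ev_vec_add: "ev p (v + w) = ev p v + ev p w"
  by (simp add: free_act_def foldr_add scale_right_distrib sum.distrib)

lemma ev_scl: "ev p (scl c v) = scl c (ev p v)"
  by (simp add: free_act_def foldr_scl scale_sum_right mult.commute)

lemma ev_mult: "ev (p * q) v = ev p (ev q v)"
proof (induction p rule: poly_mapping_single_induct)
  case (single w c)
  show ?case
  proof (induction q rule: poly_mapping_single_induct)
    case (single u d)
    show ?case
      by (simp add: mult_single ev_single plus_word_def foldr_scl)
  qed (simp add: distrib_left ev_add ev_vec_add)
qed (simp add: distrib_right ev_add)

lemma ev_const: "ev (fconst c) v = scl c v"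
  by (simp add: fconst_def ev_single zero_word_def)

lemma ev_1: "ev 1 v = v"
  using ev_const[of 1] by (simp add: fconst_simps)

lemma ev_0: "ev 0 v = 0"
  by (simp add: free_act_def)

lemma ev_numeral: "ev (numeral k) v = scl (numeral k) v"
  using ev_const[of "numeral k"] by (simp add: fconst_simps)

lemma ev_diff: "ev (p - q) v = ev p v - ev q v"
  using ev_add[of "p - q" q] by (simp add: algebra_simps)

lemma ev_gen: "ev (fgen g) v = T g v"
  by (simp add: fgen_def ev_single)

lemmas ev_simps = ev_mult ev_add ev_diff ev_const ev_1 ev_0 ev_numeral ev_gen power2_eq_square

lemma ev_Idl:
  assumes "\<And>r v. r \<in> R \<Longrightarrow> ev r v = 0" and "p \<in> Idl\<^bsub>free_ring\<^esub> R"
  shows "ev p v = 0"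
proof -
  have z: "ev x 0 = 0" for x using ev_scl[of x 0 0] by simp
  have "Idl\<^bsub>free_ring\<^esub> R \<subseteq> {p. \<forall>v. ev p v = 0}"
    by (rule genideal_free_ring_subset) (auto simp: assms(1) ev_simps z)
  then show ?thesis using assms(2) by auto
qed

end


lemma vector_space_fconst: "vector_space (\<lambda>c (x :: 'g free_algebra). fconst c * x)"
  by unfold_locales (simp_all add: fconst_simps algebra_simps)

lemma foldr_left_mult: "foldr (\<lambda>g x. s g * x) l x = prod_list (map s l) * (x :: 'a::monoid_mult)"
  by (induction l) (simp_all add: mult.assoc)

lemma free_subst_mult: "free_act (\<lambda>c x. fconst c * x) (\<lambda>g x. s g * x) p x = free_subst s p * x"
  by (simp add: free_act_def free_subst_def foldr_left_mult sum_distrib_right mult.assoc)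

lemma free_eval_subst: "free_eval (\<lambda>c (x :: 'h free_algebra). fconst c * x) (\<lambda>g x. s g * x)"
proof -
  have "s g * (fconst c * v) = fconst c * (s g * v)" for g c v
    by (metis fconst_commute mult.assoc)
  then show ?thesis
    by (intro free_eval.intro vector_space_fconst free_eval_axioms.intro) (simp_all add: distrib_left)
qed

lemma free_subst_simps:
  "free_subst s (p + q) = free_subst s p + free_subst s q"
  "free_subst s (p - q) = free_subst s p - free_subst s q"
  "free_subst s (p * q) = free_subst s p * free_subst s q"
  "free_subst s (fconst c) = fconst c"
  "free_subst s (fgen g) = s g"
  "free_subst s 1 = 1" "free_subst s 0 = 0" "free_subst s (numeral k) = numeral k"
proof -
  interpret free_eval "\<lambda>c x. fconst c * x" "\<lambda>g x. s g * x" by (rule free_eval_subst)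
  note e = free_subst_mult[of s _ 1, symmetric, simplified]
  show "free_subst s (p + q) = free_subst s p + free_subst s q"
    "free_subst s (p - q) = free_subst s p - free_subst s q"
    "free_subst s (fconst c) = fconst c"
    "free_subst s (fgen g) = s g"
    "free_subst s 1 = 1" "free_subst s 0 = 0" "free_subst s (numeral k) = numeral k"
    by (simp_all add: e ev_add ev_diff ev_const ev_gen ev_1 ev_0 ev_numeral fconst_simps)
  show "free_subst s (p * q) = free_subst s p * free_subst s q"
    using ev_mult[of p q 1] by (simp add: free_subst_mult)
qed

lemma zeta_rel_1:
  fixes w E F H :: "'a::ring_1"
  assumes c: "E * w = w * E" "F * w = w * F" "H * w = w * H"
  defines "A \<equiv> (1 + w) * E + (1 - w) * F - w * H"
    and "r1 \<equiv> H * E - E * H - 2 * E" and "r2 \<equiv> H * F - F * H + 2 * F" and "r3 \<equiv> E * F - F * E - H"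
  shows "(A * A * H - 2 * A * H * A + H * A * A) - 4 * (H + w * A) =
      ((1 + w) * r1 + (1 - w) * r2) * A - A * ((1 + w) * r1 + (1 - w) * r2)
      + 4 * (1 + w) * (1 - w) * r3 + 2 * (1 + w) * w * r1 - 2 * (1 - w) * w * r2"
proof -
  have c': "E * (w * x) = w * (E * x)" "F * (w * x) = w * (F * x)" "H * (w * x) = w * (H * x)" for x
    by (simp_all add: c mult.assoc[symmetric])
  have n: "4 * x = x + x + x + x" "2 * x = x + x" for x :: 'a
  proof -
    have "(4 :: 'a) = 1 + 1 + 1 + 1" by simp
    then show "4 * x = x + x + x + x" by (simp only: distrib_right mult_1_left)
  qed (rule mult_2)
  show ?thesis
    unfolding A_def r1_def r2_def r3_def by (simp add: algebra_simps c c' n)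
qed

lemma zeta_rel_2:
  fixes w E F H :: "'a::ring_1"
  assumes c: "E * w = w * E" "F * w = w * F" "H * w = w * H"
  defines "A \<equiv> (1 + w) * E + (1 - w) * F - w * H"
    and "r1 \<equiv> H * E - E * H - 2 * E" and "r2 \<equiv> H * F - F * H + 2 * F"
  shows "(H * H * A - 2 * H * A * H + A * H * H) - 4 * (A + w * H) =
      H * ((1 + w) * r1 + (1 - w) * r2) - ((1 + w) * r1 + (1 - w) * r2) * H
      + 2 * (1 + w) * r1 - 2 * (1 - w) * r2"
proof -
  have c': "E * (w * x) = w * (E * x)" "F * (w * x) = w * (F * x)" "H * (w * x) = w * (H * x)" for x
    by (simp_all add: c mult.assoc[symmetric])
  have n: "4 * x = x + x + x + x" "2 * x = x + x" for x :: 'a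
  proof -
    have "(4 :: 'a) = 1 + 1 + 1 + 1" by simp
    then show "4 * x = x + x + x + x" by (simp only: distrib_right mult_1_left)
  qed (rule mult_2)
  show ?thesis
    unfolding A_def r1_def r2_def by (simp add: algebra_simps c c' n)
qed

lemma zeta_rels:
  assumes "r \<in> K_rels \<omega>"
  shows "free_subst (zeta_gen \<omega>) r \<in> Idl\<^bsub>free_ring\<^esub> sl2_rels"
proof -
  let ?I = "Idl\<^bsub>free_ring\<^esub> sl2_rels"
  define w where "w = (fconst \<omega> :: sl2_gen free_algebra)"
  define t where "t = (fconst (1/2) :: sl2_gen free_algebra)"
  define E F H where "E = fgen gE" and "F = fgen gF" and "H = fgen gH"
  define r1 r2 r3 where "r1 = H * E - E * H - 2 * E" and "r2 = H * F - F * H + 2 * F"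
    and "r3 = E * F - F * E - H"
  define A where "A = (1 + w) * E + (1 - w) * F - w * H"
  have tc: "x * t = t * x" and wc: "x * w = w * x" for x
    unfolding t_def w_def by (metis fconst_commute)+
  have tc': "x * (t * y) = t * (x * y)" for x y
    by (simp add: tc mult.assoc[symmetric])
  have tt: "t * t * t * 4 = t"
    by (simp add: t_def flip: fconst_simps)
  have gA: "zeta_gen \<omega> gA = t * A" and gB: "zeta_gen \<omega> gB = t * H"
  proof -
    have "fconst ((1 + \<omega>) / 2) = t * (1 + w)" "fconst (\<omega> / 2) = t * w"
      by (simp_all add: t_def w_def flip: fconst_simps)
    moreover have "fconst ((1 - \<omega>) / 2) = t * (1 - w)"
      by (simp add: t_def w_def flip: fconst_simps)
    ultimately show "zeta_gen \<omega> gA = t * A"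
      by (simp add: A_def E_def F_def H_def distrib_left right_diff_distrib distrib_right left_diff_distrib mult.assoc)
  qed (simp add: t_def H_def)
  have r: "r1 \<in> ?I" "r2 \<in> ?I" "r3 \<in> ?I"
    using rels_subset[of sl2_rels]
    by (auto simp: sl2_rels_def Let_def r1_def r2_def r3_def E_def F_def H_def)
  have X: "(1 + w) * r1 + (1 - w) * r2 \<in> ?I"
    by (intro rels_ideal_closed(2) rels_ideal_closed(4) r)
  have 1: "(A * A * H - 2 * A * H * A + H * A * A) - 4 * (H + w * A) \<in> ?I"
    unfolding A_def zeta_rel_1[of E w F H, OF wc wc wc, folded r1_def r2_def r3_def]
    by (simp only: A_def[symmetric])
      (intro rels_ideal_closed(2,3) rels_ideal_closed(4)[OF X] rels_ideal_closed(5)[OF X]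
        rels_ideal_closed(4)[OF r(1)] rels_ideal_closed(4)[OF r(2)] rels_ideal_closed(4)[OF r(3)])
  have 2: "(H * H * A - 2 * H * A * H + A * H * H) - 4 * (A + w * H) \<in> ?I"
    unfolding A_def zeta_rel_2[of E w F H, OF wc wc wc, folded r1_def r2_def]
    by (intro rels_ideal_closed(2,3) rels_ideal_closed(4)[OF X] rels_ideal_closed(5)[OF X]
        rels_ideal_closed(4)[OF r(1)] rels_ideal_closed(4)[OF r(2)])
  have red: "(t * A) * (t * A) * (t * H) - 2 * (t * A) * (t * H) * (t * A) + (t * H) * ((t * A) * (t * A))
      - (t * H + w * (t * A))
      = t * t * t * ((A * A * H - 2 * A * H * A + H * A * A) - 4 * (H + w * A))" for A H :: "sl2_gen free_algebra"
  proof -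
    have "t * t * t * (4 * (H + w * A)) = t * (H + w * A)"
      by (simp only: tt mult.assoc[symmetric])
    then show ?thesis
      by (simp add: right_diff_distrib)
        (simp add: distrib_left right_diff_distrib mult.assoc tc'[of A] tc'[of H] tc'[of w] tc'[of 2])
  qed
  from assms consider
      "r = (fgen gA)^2 * fgen gB - 2 * fgen gA * fgen gB * fgen gA + fgen gB * (fgen gA)^2
        - (fgen gB + fconst \<omega> * fgen gA)"
    | "r = (fgen gB)^2 * fgen gA - 2 * fgen gB * fgen gA * fgen gB + fgen gA * (fgen gB)^2
        - (fgen gA + fconst \<omega> * fgen gB)"
    by (auto simp: K_rels_def Let_def)
  then show ?thesis
  proof cases
    case 1
    have "free_subst (zeta_gen \<omega>) r =
       t * t * t * ((A * A * H - 2 * A * H * A + H * A * A) - 4 * (H + w * A))"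
      unfolding 1 free_subst_simps power2_eq_square gA gB w_def[symmetric] by (rule red)
    then show ?thesis
      by (simp only: rels_ideal_closed(4)[OF \<open>_ - 4 * (H + w * A) \<in> ?I\<close>])
  next
    case 2
    have "free_subst (zeta_gen \<omega>) r =
       t * t * t * ((H * H * A - 2 * H * A * H + A * H * H) - 4 * (A + w * H))"
      unfolding 2 free_subst_simps power2_eq_square gA gB w_def[symmetric] by (rule red)
    then show ?thesis
      by (simp only: rels_ideal_closed(4)[OF \<open>_ - 4 * (A + w * H) \<in> ?I\<close>])
  qed
qed

lemma zeta_pres_coset:
  "zeta \<omega> (pres_coset (K_rels \<omega>) p) = pres_coset sl2_rels (free_subst (zeta_gen \<omega>) p)"
proof -
  let ?I = "Idl\<^bsub>free_ring\<^esub> sl2_rels"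
  have sub: "Idl\<^bsub>free_ring\<^esub> (K_rels \<omega>) \<subseteq> {p. free_subst (zeta_gen \<omega>) p \<in> ?I}"
  proof (rule genideal_free_ring_subset)
    show "K_rels \<omega> \<subseteq> {p. free_subst (zeta_gen \<omega>) p \<in> ?I}"
      by (rule subsetI) (simp only: mem_Collect_eq zeta_rels)
  qed (simp_all only: free_subst_simps rels_ideal_closed mem_Collect_eq)
  have "pres_coset sl2_rels (free_subst (zeta_gen \<omega>) q) = pres_coset sl2_rels (free_subst (zeta_gen \<omega>) p)"
    if "q \<in> pres_coset (K_rels \<omega>) p" for q
  proof -
    have "free_subst (zeta_gen \<omega>) (q - p) \<in> ?I"
      using that sub unfolding pres_coset_iff by blast
    then show ?thesis by (simp only: pres_coset_eq_iff free_subst_simps)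
  qed
  then show ?thesis
    unfolding zeta_def by (rule the_elem_image[OF pres_coset_self])
qed

lemma zeta_hom: "zeta \<omega> \<in> calg_hom (K_alg \<omega>) U_sl2"
  by (auto simp: calg_hom_def ring_hom_def K_alg_def U_sl2_def pres_carrier pres_ops
        zeta_pres_coset free_subst_simps)

lemma zeta_gens:
  defines "E \<equiv> pres_gen sl2_rels gE" and "F \<equiv> pres_gen sl2_rels gF" and "H \<equiv> pres_gen sl2_rels gH"
  shows "zeta \<omega> (K_A \<omega>) =
      ((1 + \<omega>) / 2) \<odot>\<^bsub>U_sl2\<^esub> E \<oplus>\<^bsub>U_sl2\<^esub> ((1 - \<omega>) / 2) \<odot>\<^bsub>U_sl2\<^esub> F \<oplus>\<^bsub>U_sl2\<^esub> (- (\<omega> / 2)) \<odot>\<^bsub>U_sl2\<^esub> H"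
    and "zeta \<omega> (K_B \<omega>) = (1 / 2) \<odot>\<^bsub>U_sl2\<^esub> H"
proof -
  show "zeta \<omega> (K_A \<omega>) =
      ((1 + \<omega>) / 2) \<odot>\<^bsub>U_sl2\<^esub> E \<oplus>\<^bsub>U_sl2\<^esub> ((1 - \<omega>) / 2) \<odot>\<^bsub>U_sl2\<^esub> F \<oplus>\<^bsub>U_sl2\<^esub> (- (\<omega> / 2)) \<odot>\<^bsub>U_sl2\<^esub> H"
    and "zeta \<omega> (K_B \<omega>) = (1 / 2) \<odot>\<^bsub>U_sl2\<^esub> H"
    by (simp_all add: assms pres_gen_def zeta_pres_coset free_subst_simps U_sl2_def pres_ops
          fconst_simps(3))
qed


lemma lookup_Lscale [simp]: "Poly_Mapping.lookup (Lscale c v) i = c * Poly_Mapping.lookup v i"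
  by (simp add: Lscale_def map.rep_eq when_def)

lemma vector_space_Lscale: "vector_space Lscale"
  by unfold_locales (auto intro!: poly_mapping_eqI simp: lookup_add algebra_simps)

lemma lookup_Lvec: "Poly_Mapping.lookup (Lvec i) j = (if i = j then 1 else 0)"
  by (simp add: Lvec_def lookup_single when_def)

interpretation Lvs: vector_space Lscale by (rule vector_space_Lscale)

lemma L_op_superset:
  assumes "finite S" "Poly_Mapping.keys v \<subseteq> S"
  shows "L_op n g v = (\<Sum>i\<in>S. Lscale (Poly_Mapping.lookup v i) (L_basis_op n g i))"
  unfolding L_op_def using assms by (intro sum.mono_neutral_left) (auto simp: in_keys_iff)

lemma L_op_add: "L_op n g (v + w) = L_op n g v + L_op n g w"
proof -
  let ?S = "Poly_Mapping.keys v \<union> Poly_Mapping.keys w"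
  have "Poly_Mapping.keys (v + w) \<subseteq> ?S" by (rule keys_add)
  then show ?thesis
    by (simp add: L_op_superset[of ?S] lookup_add Lvs.scale_left_distrib sum.distrib)
qed

lemma L_op_scale: "L_op n g (Lscale c v) = Lscale c (L_op n g v)"
proof -
  have "Poly_Mapping.keys (Lscale c v) \<subseteq> Poly_Mapping.keys v"
    by (auto simp: in_keys_iff)
  then show ?thesis
    by (simp add: L_op_superset[of "Poly_Mapping.keys v"] Lvs.scale_sum_right)
qed

lemma L_op_Lvec: "L_op n g (Lvec i) = L_basis_op n g i"
  by (subst L_op_superset[of "{i}"]) (auto simp: Lvec_def)

interpretation Lev: free_eval Lscale "L_op n" for n
  by unfold_locales (simp_all add: L_op_add L_op_scale)

lemma L_rels:
  assumes "r \<in> sl2_rels"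
  shows "free_act Lscale (L_op n) r v = 0"
proof (induction v rule: poly_mapping_single_induct)
  case (add p q)
  then show ?case by (simp add: Lev.ev_vec_add)
next
  case (single i c)
  have s: "Poly_Mapping.single i c = Lscale c (Lvec i)"
    by (rule poly_mapping_eqI) (simp add: Lvec_def lookup_single when_def)
  have z: "L_op n g 0 = 0" and m: "L_op n g (- x) = - L_op n g x" for n g x
    using L_op_scale[of n g 0 0] L_op_scale[of n g "-1" x] by simp_all
  have d: "L_op n g (x - y) = L_op n g x - L_op n g y" for n g x y
    using L_op_add[of n g "x - y" y] by (simp add: algebra_simps)
  have ev: "free_act Lscale (L_op n) r (Lvec i) = 0"
  proof -
    have "i = 0 \<or> (\<exists>k. i = Suc k \<and> i < n) \<or> (\<exists>k. i = Suc k \<and> i = n) \<or> n < i"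
      by (cases i) auto
    moreover from assms have
        "r = fgen gH * fgen gE - fgen gE * fgen gH - 2 * fgen gE \<or>
       r = fgen gH * fgen gF - fgen gF * fgen gH + 2 * fgen gF \<or>
       r = fgen gE * fgen gF - fgen gF * fgen gE - fgen gH"
      by (auto simp: sl2_rels_def Let_def)
    ultimately have "Poly_Mapping.lookup (free_act Lscale (L_op n) r (Lvec i)) k = 0" for k
      by (elim disjE exE conjE; hypsubst)
        (auto simp: Lev.ev_simps L_op_Lvec L_op_scale L_op_add z m d lookup_add lookup_minus
          lookup_Lvec ring_distribs of_nat_diff simp del: Lvs.scale_scale)
    then show ?thesis by (intro poly_mapping_eqI) simp
  qed
  then show ?case by (simp add: s Lev.ev_scl ev)
qed

lemma L_act_pres_coset: "L_act n (pres_coset sl2_rels p) v = free_act Lscale (L_op n) p v"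
proof -
  have "free_act Lscale (L_op n) q v = free_act Lscale (L_op n) p v" if "q \<in> pres_coset sl2_rels p" for q
    using Lev.ev_Idl[OF L_rels that[unfolded pres_coset_iff]] by (simp add: Lev.ev_diff)
  then show ?thesis
    unfolding L_act_def by (rule the_elem_image[OF pres_coset_self])
qed

lemma L_op_closed:
  assumes "v \<in> L_space n"
  shows "L_op n g v \<in> L_space n"
  using assms unfolding L_space_def
proof (induction rule: Lvs.span_induct_alt)
  case base
  show ?case by (simp add: L_op_def Lvs.span_zero)
next
  case (step c x y)
  then obtain i where "i \<le> n" "x = Lvec i" by auto
  have b: "Lscale d (Lvec j) \<in> module.span Lscale (Lvec ` {0..n})" if "j \<le> n" for d j
    by (rule Lvs.span_scale, rule Lvs.span_base, rule imageI) (use that in simp)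
  have "L_op n g x \<in> module.span Lscale (Lvec ` {0..n})"
    unfolding \<open>x = Lvec i\<close> L_op_Lvec using \<open>i \<le> n\<close>
    by (cases g) (simp_all only: L_basis_op.simps split: if_splits, auto intro: b Lvs.span_zero simp del: of_nat_add of_nat_diff)
  then show ?case
    using step by (simp add: L_op_add L_op_scale Lvs.span_add Lvs.span_scale)
qed

lemma calg_module_L: "calg_module Lscale U_sl2 (L_space n) (L_act n)"
proof -
  have "foldr (L_op n) l v \<in> L_space n" if "v \<in> L_space n" for l v
    using that by (induction l) (auto intro: L_op_closed)
  then have "Lscale c (foldr (L_op n) l v) \<in> L_space n" if "v \<in> L_space n" for c l v
    using that unfolding L_space_def by (blast intro: Lvs.span_scale)
  then have closed: "free_act Lscale (L_op n) p v \<in> L_space n" if "v \<in> L_space n" for p v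
    using that unfolding free_act_def L_space_def by (blast intro: Lvs.span_sum)
  have sub: "Lvs.subspace (L_space n)"
    by (simp add: L_space_def)
  show ?thesis
    unfolding U_sl2_def
    by (intro calg_module.intro calg_module_axioms.intro vector_space_Lscale sub)
      (auto simp only: pres_carrier pres_ops L_act_pres_coset closed Lev.ev_add Lev.ev_mult
         Lev.ev_const Lev.ev_1 Lev.ev_vec_add Lev.ev_scl)
qed

lemma L_act_basis:
  "1 \<le> i \<Longrightarrow> i \<le> n \<Longrightarrow>
     L_act n (pres_gen sl2_rels gE) (Lvec i) = Lscale (of_nat (n - i + 1)) (Lvec (i - 1))"
  "L_act n (pres_gen sl2_rels gE) (Lvec 0) = 0"
  "i < n \<Longrightarrow> L_act n (pres_gen sl2_rels gF) (Lvec i) = Lscale (of_nat (i + 1)) (Lvec (i + 1))"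
  "L_act n (pres_gen sl2_rels gF) (Lvec n) = 0"
  "i \<le> n \<Longrightarrow> L_act n (pres_gen sl2_rels gH) (Lvec i) = Lscale (of_nat n - 2 * of_nat i) (Lvec i)"
  by (simp_all add: pres_gen_def L_act_pres_coset Lev.ev_gen L_op_Lvec)

end

theory Submission
  imports Defs "HOL-Computational_Algebra.Fundamental_Theorem_Algebra"
begin

text \<open>
  With \<open>c = [a, b]\<close> the relations read \<open>[a, c] = b + \<omega>a\<close> and \<open>[b, c] = -(a + \<omega>b)\<close>, so modules over the
  algebra are modules over a three-dimensional Lie algebra. If \<open>\<omega> = -1\<close>, the elements \<open>c \<plusminus> (a - b)\<close> are
  eigenvectors of both \<open>ad a\<close> and \<open>ad b\<close> with eigenvalue \<open>\<minusplus>1\<close>: their kernels are submodules, and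
  nonzero because they shift the finitely many eigenvalues of \<open>a\<close>. Hence they act by zero on an
  irreducible module, so \<open>a = b\<close> there. The case \<open>\<omega> = 1\<close> reduces to this one by replacing \<open>b\<close> by \<open>-b\<close>.
  If \<open>\<omega>\<^sup>2 \<noteq> 1\<close>, the Lie algebra is \<open>sl\<^sub>2\<close>, and the vectors \<open>F\<^sup>i v / i!\<close> obtained from a highest weight
  vector \<open>v\<close> define a nonzero intertwiner from some \<open>L\<^sub>m\<close>, which is an isomorphism by Schur's lemma.
\<close>

section \<open>Linear maps on finite-dimensional subspaces\<close>

locale fd_subspace = vector_space scl
  for scl :: "complex \<Rightarrow> 'v::ab_group_add \<Rightarrow> 'v" +
  fixes V :: "'v set"
  assumes fd: "\<exists>S. finite S \<and> span S = V"
begin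

lemma subspace_V: "subspace V"
  using fd subspace_span by blast

lemmas V_closed [simp] =
  subspace_0[OF subspace_V] subspace_add[OF subspace_V] subspace_diff[OF subspace_V]
  subspace_neg[OF subspace_V] subspace_scale[OF subspace_V]

text \<open>The span of \<open>S\<close> cannot contain \<open>card S + 1\<close> independent
  vectors. Coefficients belong to indices, not to vectors, so a repetition in the sequence is itself
  a relation.\<close>

lemma sequence_dependent:
  fixes u :: "nat \<Rightarrow> 'v"
  assumes u: "\<And>i. u i \<in> V"
  obtains N c where "\<exists>i\<le>N. c i \<noteq> 0" "(\<Sum>i\<le>N. scl (c i) (u i)) = 0"
proof -
  obtain S where S: "finite S" "span S = V" using fd by blast
  have "\<exists>c. (\<exists>i\<le>card S. c i \<noteq> 0) \<and> (\<Sum>i\<le>card S. scl (c i) (u i)) = 0"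
  proof (cases "inj_on u {..card S}")
    case True
    have "dependent (u ` {..card S})"
    proof (rule ccontr)
      assume "\<not> dependent (u ` {..card S})"
      then have "card (u ` {..card S}) \<le> card S"
        using independent_span_bound[OF S(1)] u S(2) by blast
      then show False by (simp add: card_image[OF True])
    qed
    then obtain k where "\<exists>v\<in>u ` {..card S}. k v \<noteq> 0"
        "(\<Sum>v\<in>u ` {..card S}. scl (k v) v) = 0"
      by (auto simp: dependent_finite)
    then show ?thesis
      by (intro exI[of _ "k \<circ> u"]) (auto simp: sum.reindex[OF True])
  next
    case False
    then obtain i j where ij: "i \<le> card S" "j \<le> card S" "i \<noteq> j" "u i = u j"
      by (auto simp: inj_on_def)
    define c :: "nat \<Rightarrow> complex" where "c k = (if k = i then 1 else 0) - (if k = j then 1 else 0)" for k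
    have "(\<Sum>k\<le>card S. scl (c k) (u k))
        = (\<Sum>k\<le>card S. if k = i then u k else 0) - (\<Sum>k\<le>card S. if k = j then u k else 0)"
      unfolding sum_subtractf[symmetric] by (rule sum.cong) (auto simp: c_def)
    also have "\<dots> = 0" using ij by simp
    finally show ?thesis using ij by (intro exI[of _ c]) (auto simp: c_def)
  qed
  then show thesis using that by blast
qed

text \<open>Linearity is asked on \<open>V\<close> only, since a module action is unconstrained
  outside its carrier.\<close>

definition endo :: "('v \<Rightarrow> 'v) \<Rightarrow> bool" where
  "endo T \<longleftrightarrow> (\<forall>v\<in>V. T v \<in> V) \<and> (\<forall>v\<in>V. \<forall>w\<in>V. T (v + w) = T v + T w) \<and>
     (\<forall>c. \<forall>v\<in>V. T (scl c v) = scl c (T v))"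

lemma endo_simps:
  assumes "endo T"
  shows "v \<in> V \<Longrightarrow> T v \<in> V"
    and "\<lbrakk>v \<in> V; w \<in> V\<rbrakk> \<Longrightarrow> T (v + w) = T v + T w"
    and "v \<in> V \<Longrightarrow> T (scl c v) = scl c (T v)"
    and "\<lbrakk>v \<in> V; w \<in> V\<rbrakk> \<Longrightarrow> T (v - w) = T v - T w"
    and "v \<in> V \<Longrightarrow> T (- v) = - T v"
    and "T 0 = 0"
proof -
  note e = assms[unfolded endo_def]
  show "v \<in> V \<Longrightarrow> T v \<in> V" and "v \<in> V \<Longrightarrow> T (scl c v) = scl c (T v)"
    and add: "\<lbrakk>v \<in> V; w \<in> V\<rbrakk> \<Longrightarrow> T (v + w) = T v + T w" for v w
    using e by auto
  show "T (v - w) = T v - T w" if "v \<in> V" "w \<in> V"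
    using add[of "v - w" w] that by simp
  have "T (scl (-1) v) = scl (-1) (T v)" if "v \<in> V" using e that by blast
  then show "v \<in> V \<Longrightarrow> T (- v) = - T v" by simp
  have "T (scl 0 0) = scl 0 (T 0)" using e V_closed(1) by blast
  then show "T 0 = 0" by simp
qed

lemma endo_kernel: "endo T \<Longrightarrow> subspace {v \<in> V. T v = 0}"
  by (auto simp: subspace_def endo_simps)

section \<open>Existence of eigenvectors over the complex numbers\<close>

text \<open>Split off a root, \<open>p = (x - z) q\<close>, and put \<open>w = T v - z v\<close>.
  Either \<open>w = 0\<close> and \<open>v\<close> is an eigenvector, or \<open>q\<close>, of
  smaller degree, annihilates \<open>w\<close>.\<close>

lemma annihilating_poly_eigenvector:
  assumes T: "endo T"
  shows "\<lbrakk>p \<noteq> 0; v \<in> V; v \<noteq> 0; (\<Sum>i\<le>degree p. scl (poly.coeff p i) ((T ^^ i) v)) = 0\<rbrakk>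
    \<Longrightarrow> \<exists>w\<in>V. w \<noteq> 0 \<and> (\<exists>l. T w = scl l w)"
proof (induction "degree p" arbitrary: p v)
  case 0
  then have "scl (lead_coeff p) v = 0" by simp
  moreover have "lead_coeff p \<noteq> 0" using 0(2) by simp
  ultimately show ?case using 0(4) by simp
next
  case (Suc d)
  then have "\<not> constant (poly p)" by (simp add: constant_degree)
  then obtain z where "poly p z = 0"
    using fundamental_theorem_of_algebra by blast
  then obtain q where p: "p = [:- z, 1:] * q"
    by (auto simp: poly_eq_0_iff_dvd dvd_def)
  with \<open>p \<noteq> 0\<close> have q: "q \<noteq> 0" by auto
  then have dq: "degree q = d"
    using Suc(2) by (simp add: p degree_mult_eq del: mult_pCons_left)
  have pow: "(T ^^ i) x \<in> V" if "x \<in> V" for x i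
    using that by (induction i) (auto simp: endo_simps[OF T])
  define w where "w = T v - scl z v"
  have Tw: "(T ^^ i) w = (T ^^ Suc i) v - scl z ((T ^^ i) v)" for i
    using Suc.prems(2) pow[OF Suc.prems(2)]
    by (induction i) (simp_all add: w_def endo_simps[OF T])
  have cp: "poly.coeff p (Suc i) = poly.coeff q i - z * poly.coeff q (Suc i)"
      "poly.coeff p 0 = - z * poly.coeff q 0" for i
    by (simp_all add: p)
  have q0: "poly.coeff q (Suc d) = 0" by (simp add: coeff_eq_0 dq)
  have "0 = (\<Sum>i\<le>Suc d. scl (poly.coeff p i) ((T ^^ i) v))"
    using Suc.prems(4) Suc(2) by simp
  also have "\<dots> = (\<Sum>i\<le>d. scl (poly.coeff q i) ((T ^^ Suc i) v))
      - (scl (z * poly.coeff q 0) v + (\<Sum>i\<le>d. scl (z * poly.coeff q (Suc i)) ((T ^^ Suc i) v)))"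
    by (simp only: sum.atMost_Suc_shift cp) (simp add: scale_left_diff_distrib sum_subtractf)
  also have "scl (z * poly.coeff q 0) v + (\<Sum>i\<le>d. scl (z * poly.coeff q (Suc i)) ((T ^^ Suc i) v))
      = (\<Sum>i\<le>Suc d. scl (z * poly.coeff q i) ((T ^^ i) v))"
    by (subst sum.atMost_Suc_shift) simp
  also have "\<dots> = (\<Sum>i\<le>d. scl (z * poly.coeff q i) ((T ^^ i) v))"
    by (simp add: q0)
  finally have "(\<Sum>i\<le>d. scl (poly.coeff q i) ((T ^^ i) w)) = 0"
    by (simp add: Tw scale_right_diff_distrib sum_subtractf mult.commute)
  moreover have "w \<in> V" using Suc.prems(2) by (simp add: w_def endo_simps[OF T])
  ultimately show ?case
    using Suc(1)[OF dq[symmetric] q, of w] Suc.prems(2,3) dq by (cases "w = 0") (auto simp: w_def)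
qed

text \<open>The iterates \<open>(T ^^ i) v\<close> of one nonzero vector are dependent, and a
  relation between them is a nonzero polynomial in \<open>T\<close> annihilating
  \<open>v\<close>.\<close>

lemma eigenvector:
  assumes T: "endo T" and "V \<noteq> {0}"
  obtains v l where "v \<in> V" "v \<noteq> 0" "T v = scl l v"
proof -
  obtain v where v: "v \<in> V" "v \<noteq> 0" using assms(2) V_closed(1) by blast
  have pow: "(T ^^ i) v \<in> V" for i
    using v by (induction i) (auto simp: endo_simps[OF T])
  obtain N c where c: "\<exists>i\<le>N. c i \<noteq> 0" "(\<Sum>i\<le>N. scl (c i) ((T ^^ i) v)) = 0"
    using sequence_dependent[of "\<lambda>i. (T ^^ i) v", OF pow] .
  define p where "p = (\<Sum>i\<le>N. monom (c i) i)"
  have cp: "poly.coeff p i = (if i \<le> N then c i else 0)" for i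
    by (simp add: p_def coeff_sum sum.delta)
  have "p \<noteq> 0" using c(1) cp by (metis coeff_0)
  moreover have "(\<Sum>i\<le>degree p. scl (poly.coeff p i) ((T ^^ i) v)) = (\<Sum>i\<le>N. scl (c i) ((T ^^ i) v))"
  proof (rule sum.mono_neutral_cong_left)
    show "{..degree p} \<subseteq> {..N}" using degree_le[of N p] by (simp add: cp)
    then show "scl (poly.coeff p i) ((T ^^ i) v) = scl (c i) ((T ^^ i) v)" if "i \<in> {..degree p}" for i
      using that by (auto simp: cp)
    show "\<forall>i\<in>{..N} - {..degree p}. scl (c i) ((T ^^ i) v) = 0"
    proof
      fix i assume "i \<in> {..N} - {..degree p}"
      then have "c i = 0" using cp[of i] by (simp add: coeff_eq_0)
      then show "scl (c i) ((T ^^ i) v) = 0" by simp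
    qed
  qed simp
  ultimately show thesis
    using annihilating_poly_eigenvector[OF T _ v] c(2) that by metis
qed

section \<open>Independence of eigenvectors and eigenvalue shifts\<close>

text \<open>Applying \<open>T\<close> and subtracting \<open>l j\<close> times the relation removes
  \<open>u j\<close> and multiplies the other terms by the nonzero numbers \<open>l k - l j\<close>.
  Zero members are allowed, so the coefficients of a relation can be absorbed into the
  family.\<close>

lemma eigenvectors_independent:
  assumes T: "endo T" and "finite I"
  shows "\<lbrakk>inj_on l I; \<And>k. k \<in> I \<Longrightarrow> u k \<in> V \<and> T (u k) = scl (l k) (u k); (\<Sum>k\<in>I. u k) = 0\<rbrakk>
    \<Longrightarrow> \<forall>k\<in>I. u k = 0"
  using \<open>finite I\<close>
proof (induction I arbitrary: u rule: finite_induct)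
  case (insert j I)
  have sum_V: "(\<Sum>k\<in>J. u k) \<in> V \<and> T (\<Sum>k\<in>J. u k) = (\<Sum>k\<in>J. T (u k))"
    if "finite J" "J \<subseteq> insert j I" for J
    using that insert.prems(2)
    by (induction J rule: finite_induct) (auto simp: endo_simps[OF T])
  have s: "u j = - (\<Sum>k\<in>I. u k)"
    using insert.hyps insert.prems(3) by (simp add: eq_neg_iff_add_eq_0)
  have "(\<Sum>k\<in>I. scl (l k) (u k)) = T (\<Sum>k\<in>I. u k)"
    using sum_V[OF insert.hyps(1) subset_insertI] insert.prems(2) by simp
  also have "\<dots> = - T (u j)" using sum_V[OF insert.hyps(1) subset_insertI] by (simp add: s endo_simps[OF T])
  also have "\<dots> = (\<Sum>k\<in>I. scl (l j) (u k))"
    using insert.prems(2)[of j] by (simp add: s scale_sum_right)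
  finally have "(\<Sum>k\<in>I. scl (l k - l j) (u k)) = 0"
    by (simp add: scale_left_diff_distrib sum_subtractf)
  then have "\<forall>k\<in>I. scl (l k - l j) (u k) = 0"
    using insert.prems(1,2) by (intro insert.IH) (auto simp: endo_simps[OF T] mult.commute)
  then have "\<forall>k\<in>I. u k = 0" using insert.prems(1) insert.hyps(2) by (auto simp: inj_on_def)
  then show ?case using s by simp
qed simp

text \<open>The eigenvalues \<open>l + k d\<close> are pairwise distinct, so nonzero
  \<open>u k\<close> would all be independent, contrary to finite dimension.\<close>

lemma shifted_sequence_vanishes:
  assumes T: "endo T" and d: "d \<noteq> 0"
    and u: "\<And>k::nat. u k \<in> V" "\<And>k. T (u k) = scl (l + of_nat k * d) (u k)"
  shows "\<exists>k. u k = 0"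
proof -
  obtain N c where N: "\<exists>i\<le>N. c i \<noteq> 0" "(\<Sum>i\<le>N. scl (c i) (u i)) = 0"
    using sequence_dependent[of u, OF u(1)] .
  have "\<forall>k\<in>{..N}. scl (c k) (u k) = 0"
    by (rule eigenvectors_independent[OF T, where l = "\<lambda>k. l + of_nat k * d"])
      (use N(2) d in \<open>auto simp: inj_on_def u endo_simps[OF T] mult.commute\<close>)
  then show ?thesis using N(1) by auto
qed

text \<open>By \<open>[T, X] = d X\<close>, the operator \<open>X\<close> shifts eigenvalues of
  \<open>T\<close> by \<open>d\<close>. Its iterates on an eigenvector therefore reach zero, and the
  last nonzero one lies in the kernel of \<open>X\<close>.\<close>

lemma shift_kernel:
  assumes T: "endo T" and X: "endo X" and d: "d \<noteq> 0" and "V \<noteq> {0}"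
    and TX: "\<And>v. v \<in> V \<Longrightarrow> T (X v) = X (T v) + scl d (X v)"
  obtains v l where "v \<in> V" "v \<noteq> 0" "X v = 0" "T v = scl l v"
proof -
  obtain v l where v: "v \<in> V" "v \<noteq> 0" "T v = scl l v" using eigenvector[OF T \<open>V \<noteq> {0}\<close>] .
  have pow: "(X ^^ k) v \<in> V" for k
    using v(1) by (induction k) (auto simp: endo_simps[OF X])
  have eig: "T ((X ^^ k) v) = scl (l + of_nat k * d) ((X ^^ k) v)" for k
    by (induction k) (use v(3) in \<open>simp_all add: TX pow endo_simps[OF X] algebra_simps\<close>)
  have ex: "\<exists>k. (X ^^ k) v = 0"
    by (rule shifted_sequence_vanishes[OF T d pow eig])
  define k where "k = (LEAST k. (X ^^ k) v = 0)"
  have k: "(X ^^ k) v = 0" unfolding k_def by (rule LeastI_ex[OF ex])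
  with v(2) obtain j where j: "k = Suc j" by (cases k) auto
  then have "(X ^^ j) v \<noteq> 0" using not_less_Least[of j "\<lambda>k. (X ^^ k) v = 0"] k_def by simp
  with k j show thesis using that[of "(X ^^ j) v"] pow eig by simp
qed

end


section \<open>Pairs of operators satisfying the defining relations\<close>

locale K_rep = fd_subspace scl V
  for scl :: "complex \<Rightarrow> 'v::ab_group_add \<Rightarrow> 'v" and V +
  fixes w :: complex and a b :: "'v \<Rightarrow> 'v"
  assumes endo_a: "endo a" and endo_b: "endo b"
    and rel_a: "v \<in> V \<Longrightarrow> a (a (b v)) - scl 2 (a (b (a v))) + b (a (a v)) = b v + scl w (a v)"
    and rel_b: "v \<in> V \<Longrightarrow> b (b (a v)) - scl 2 (b (a (b v))) + a (b (b v)) = a v + scl w (b v)"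
begin

definition c :: "'v \<Rightarrow> 'v" where "c v = a (b v) - b (a v)"

lemma endo_c: "endo c"
  by (simp add: endo_def c_def endo_simps[OF endo_a] endo_simps[OF endo_b] algebra_simps)

lemmas ab_simps = endo_simps[OF endo_a] endo_simps[OF endo_b]
lemmas abc_simps = ab_simps endo_simps[OF endo_c]

lemma scl_2: "scl 2 x = x + x"
  using scale_left_distrib[of 1 1 x] by simp

text \<open>Together with \<open>ac\<close> and \<open>bc\<close> this sorts products of operators
  into the order \<open>c\<close>, \<open>b\<close>, \<open>a\<close>, a PBW normal form in which
  the commutator identities below can be compared.\<close>

lemma ab: "v \<in> V \<Longrightarrow> a (b v) = b (a v) + c v"
  by (simp add: c_def)

lemma ac: "v \<in> V \<Longrightarrow> a (c v) = c (a v) + b v + scl w (a v)"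
  using rel_a[of v, symmetric] by (simp add: c_def ab_simps scl_2 algebra_simps)

lemma bc: "v \<in> V \<Longrightarrow> b (c v) = c (b v) - a v - scl w (b v)"
  using rel_b[of v] by (simp add: c_def ab_simps scl_2 algebra_simps)

text \<open>The left side of the first relation is odd in \<open>b\<close> and that of the second is
  even, so a sign change of \<open>b\<close> passes to \<open>w\<close>.\<close>

lemma minus_b: "K_rep scl V (- w) a (\<lambda>v. - b v)"
proof
  show "endo a" by (rule endo_a)
  show "endo (\<lambda>v. - b v)" by (simp add: endo_def ab_simps)
  fix v assume "v \<in> V"
  then show "a (a (- b v)) - scl 2 (a (- b (a v))) + - b (a (a v)) = - b v + scl (- w) (a v)"
    using rel_a[of v] by (simp add: ab_simps algebra_simps)
  show "- b (- b (a v)) - scl 2 (- b (a (- b v))) + a (- b (- b v)) = a v + scl (- w) (- b v)"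
    using rel_b[of v] \<open>v \<in> V\<close> by (simp add: ab_simps algebra_simps)
qed

section \<open>Irreducible pairs and the case \<open>w = -1\<close>\<close>

definition invariant :: "'v set \<Rightarrow> bool" where
  "invariant W \<longleftrightarrow> subspace W \<and> W \<subseteq> V \<and> (\<forall>v\<in>W. a v \<in> W \<and> b v \<in> W)"

definition irreducible :: bool where
  "irreducible \<longleftrightarrow> V \<noteq> {0} \<and> (\<forall>W. invariant W \<longrightarrow> W = {0} \<or> W = V)"

lemma ad_eigenvector_acts_by_zero:
  assumes irr: irreducible and X: "endo X" and d: "d \<noteq> 0"
    and aX: "\<And>v. v \<in> V \<Longrightarrow> a (X v) = X (a v) + scl d (X v)"
    and bX: "\<And>v. v \<in> V \<Longrightarrow> b (X v) = X (b v) + scl d (X v)"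
    and "v \<in> V"
  shows "X v = 0"
proof -
  obtain u where u: "u \<in> V" "u \<noteq> 0" "X u = 0"
    using shift_kernel[OF endo_a X d _ aX] irr by (auto simp: irreducible_def)
  have "X (a v) = 0 \<and> X (b v) = 0" if "v \<in> V" "X v = 0" for v
    using aX[OF that(1)] bX[OF that(1)] that(2) by (simp add: ab_simps)
  then have "invariant {v \<in> V. X v = 0}"
    using endo_kernel[OF X] by (simp add: invariant_def ab_simps)
  then have "{v \<in> V. X v = 0} = V" using irr u unfolding irreducible_def by blast
  then show ?thesis using \<open>v \<in> V\<close> by blast
qed

text \<open>Once \<open>X\<close> and \<open>Y\<close> act by zero, so does half their difference
  \<open>a - b\<close>. An eigenvector of \<open>a\<close> then spans an invariant line, which must
  be \<open>V\<close>.\<close>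

lemma irreducible_solvable:
  assumes w: "w = -1" and irr: irreducible
  obtains v l where "v \<noteq> 0" "V = span {v}" "\<And>x. x \<in> V \<Longrightarrow> a x = scl l x \<and> b x = scl l x"
proof -
  note wl = w scale_minus_left scale_one
  define X where "X v = c v + (a v - b v)" for v
  define Y where "Y v = c v - (a v - b v)" for v
  have endo_X: "endo X" and endo_Y: "endo Y"
    by (simp_all add: endo_def X_def Y_def abc_simps algebra_simps)
  have XV: "V \<noteq> {0}" using irr by (simp add: irreducible_def)
  have aX: "a (X v) = X (a v) + scl (-1) (X v)" and aY: "a (Y v) = Y (a v) + scl 1 (Y v)"
    and bX: "b (X v) = X (b v) + scl (-1) (X v)" and bY: "b (Y v) = Y (b v) + scl 1 (Y v)"
    if "v \<in> V" for v
    using that by (simp_all add: X_def Y_def abc_simps ab ac bc wl algebra_simps)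
  have X0: "X v = 0" and Y0: "Y v = 0" if "v \<in> V" for v
    using ad_eigenvector_acts_by_zero[OF irr endo_X _ aX bX that]
      ad_eigenvector_acts_by_zero[OF irr endo_Y _ aY bY that] by simp_all
  have ba: "b v = a v" if "v \<in> V" for v
  proof -
    have "scl 2 (a v - b v) = X v - Y v" by (simp add: X_def Y_def scl_2)
    then show ?thesis using X0[OF that] Y0[OF that] by simp
  qed
  obtain v l where v: "v \<in> V" "v \<noteq> 0" "a v = scl l v" using eigenvector[OF endo_a XV] .
  have sub: "span {v} \<subseteq> V" using v(1) subspace_V by (simp add: span_minimal)
  have al: "a x = scl l x" if "x \<in> span {v}" for x
    using that v by (auto simp: span_singleton ab_simps mult.commute)
  have "invariant (span {v})"
    using sub al ba by (auto simp: invariant_def span_scale)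
  moreover have "span {v} \<noteq> {0}" using v(2) span_base[of v "{v}"] by auto
  ultimately have "V = span {v}" using irr unfolding irreducible_def by blast
  then show thesis using that[of v l] v(2) al ba by auto
qed

section \<open>Highest weight vectors in the case \<open>w\<^sup>2 \<noteq> 1\<close>\<close>

text \<open>The two formulas are the action of \<open>zeta\<close> of the generators on the basis of
  \<open>L_space m\<close>, with \<open>u i\<close> in place of \<open>Lvec i\<close>. The index
  before the first zero of the sequence is \<open>m\<close>, and it forces the weight
  \<open>m / 2\<close> of \<open>u 0\<close>.\<close>

lemma highest_weight_basis:
  assumes w: "w\<^sup>2 \<noteq> 1" and "V \<noteq> {0}"
  obtains m u where "\<And>i. u i \<in> V" "u 0 \<noteq> 0" "u (Suc m) = 0"
    "\<And>i. i \<le> m \<Longrightarrow> b (u i) = scl (of_nat m / 2 - of_nat i) (u i)"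
    "\<And>i. i \<le> m \<Longrightarrow> a (u i) =
       scl ((1 + w) / 2) (if i = 0 then 0 else scl (of_nat (m - i + 1)) (u (i - 1)))
       + scl ((1 - w) / 2 * of_nat (i + 1)) (u (i + 1)) - scl (w * (of_nat m / 2 - of_nat i)) (u i)"
proof -
  have w1: "1 + w \<noteq> 0" "1 - w \<noteq> 0"
    using w by (auto simp: add_eq_0_iff)
  \<comment> \<open>These are \<open>(1 + w)E\<close> and \<open>(1 - w)F\<close>, obtained by solving \<open>a = \<zeta>(A)\<close>, \<open>c = [a, b]\<close> with \<open>H = 2b\<close>.\<close>
  define e where "e v = a v + scl w (b v) - c v" for v
  define f where "f v = a v + scl w (b v) + c v" for v
  have endo_e: "endo e" and endo_f: "endo f"
    by (simp_all add: endo_def e_def f_def abc_simps algebra_simps)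
  note ef_simps = endo_simps[OF endo_e] endo_simps[OF endo_f]
  have be: "b (e v) = e (b v) + scl 1 (e v)" and bf: "b (f v) = f (b v) - f v"
    and ef': "e (f v) = f (e v) + scl ((1 + w) * (1 - w)) (b v) + scl ((1 + w) * (1 - w)) (b v)"
    if "v \<in> V" for v
    using that by (simp_all add: e_def f_def abc_simps ab ac bc scl_2 algebra_simps)
  \<comment> \<open>This is \<open>[E, F] = H\<close> multiplied by \<open>(1 + w) (1 - w)\<close>,
    with \<open>H = 2 b\<close>.\<close>
  have ef: "e (f v) = f (e v) + scl (2 * (1 + w) * (1 - w)) (b v)" if "v \<in> V" for v
    using ef'[OF that] by (simp add: add.assoc mult.assoc flip: scl_2)
  obtain v l where v: "v \<in> V" "v \<noteq> 0" "e v = 0" "b v = scl l v"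
    using shift_kernel[OF endo_b endo_e _ assms(2) be] by auto
  \<comment> \<open>As \<open>f\<close> is \<open>(1 - w) F\<close>, the recursion says
    \<open>F (u i) = (i + 1) u (i + 1)\<close>, so \<open>u i\<close> is
    \<open>F^i v / i!\<close>.\<close>
  define u where "u = rec_nat v (\<lambda>i x. scl (1 / ((1 - w) * of_nat (Suc i))) (f x))"
  have u0: "u 0 = v" and uS: "u (Suc i) = scl (1 / ((1 - w) * of_nat (Suc i))) (f (u i))" for i
    by (simp_all add: u_def)
  have uV: "u i \<in> V" for i
    by (induction i) (auto simp: u0 uS v(1) ef_simps)
  have fu: "f (u i) = scl ((1 - w) * of_nat (Suc i)) (u (Suc i))" for i
    using w1(2) by (simp add: uS del: of_nat_Suc)
  have bu: "b (u i) = scl (l - of_nat i) (u i)" for i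
  proof (induction i)
    case (Suc i)
    have "b (f (u i)) = scl (l - of_nat (Suc i)) (f (u i))"
      by (simp add: bf uV Suc ef_simps algebra_simps)
    then show ?case by (simp add: uS abc_simps ef_simps uV mult.commute del: of_nat_Suc)
  qed (simp add: u0 v(4))
  \<comment> \<open>In terms of \<open>E\<close> this is \<open>E u (i + 1) = (2 l - i) u i\<close>.
    The induction runs on \<open>e (f (u i))\<close>, where \<open>ef\<close> adds the contribution
    of the weight \<open>l - i\<close> at each step.\<close>
  have eu: "e (u (Suc i)) = scl ((1 + w) * (2 * l - of_nat i)) (u i)" for i
  proof -
    have "e (f (u i)) = scl ((1 + w) * (1 - w) * of_nat (Suc i) * (2 * l - of_nat i)) (u i)"
    proof (induction i)
      case 0
      show ?case by (simp add: u0 ef v ef_simps)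
    next
      case (Suc i)
      have "f (e (u (Suc i))) = scl ((1 + w) * (2 * l - of_nat i)) (f (u i))"
        using w1(2) Suc by (simp add: uS[of i] ef_simps uV del: of_nat_Suc)
      also have "\<dots> = scl ((1 + w) * (2 * l - of_nat i) * ((1 - w) * of_nat (Suc i))) (u (Suc i))"
        by (simp add: fu)
      finally show ?case
        by (simp add: ef uV bu flip: scale_left_distrib) (simp add: algebra_simps)
    qed
    then show ?thesis using w1(2) by (simp add: uS ef_simps uV del: of_nat_Suc)
  qed
  have "\<exists>k. u k = 0"
    by (rule shifted_sequence_vanishes[OF endo_b _ uV, where d = "-1" and l = l]) (simp_all add: bu)
  define k where "k = (LEAST k. u k = 0)"
  have k: "u k = 0" unfolding k_def by (rule LeastI_ex) fact
  with u0 v(2) obtain m where m: "k = Suc m" by (cases k) auto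
  then have um: "u m \<noteq> 0" using not_less_Least[of m "\<lambda>k. u k = 0"] k_def by simp
  \<comment> \<open>Since \<open>u (Suc m) = 0\<close>, \<open>eu\<close> at \<open>m\<close> shows
    that the factor \<open>2 l - m\<close> kills the nonzero vector \<open>u m\<close>.\<close>
  have "scl ((1 + w) * (2 * l - of_nat m)) (u m) = 0"
    using eu[of m] k m by (simp add: ef_simps)
  then have "2 * l - of_nat m = 0" using um w1(1) by (simp only: scale_eq_0_iff mult_eq_0_iff) simp
  then have l: "l = of_nat m / 2" by (simp add: eq_divide_eq mult.commute)
  have a_ef: "a x = scl (1 / 2) (e x) + scl (1 / 2) (f x) - scl w (b x)" for x
  proof -
    have "e x + f x = scl 2 (a x + scl w (b x))"
      unfolding scl_2 by (simp add: e_def f_def)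
    then have "scl (1 / 2) (e x + f x) = a x + scl w (b x)" by simp
    then show ?thesis by (simp add: scale_right_distrib)
  qed
  show thesis
  proof (rule that[of u m])
    show "u i \<in> V" for i by (rule uV)
    show "u 0 \<noteq> 0" using u0 v(2) by simp
    show "u (Suc m) = 0" using k m by simp
    show "b (u i) = scl (of_nat m / 2 - of_nat i) (u i)" for i using bu l by simp
    show "a (u i) =
       scl ((1 + w) / 2) (if i = 0 then 0 else scl (of_nat (m - i + 1)) (u (i - 1)))
       + scl ((1 - w) / 2 * of_nat (i + 1)) (u (i + 1)) - scl (w * (of_nat m / 2 - of_nat i)) (u i)"
      if "i \<le> m" for i
    proof -
      \<comment> \<open>For \<open>i > 0\<close>, \<open>eu\<close> at \<open>i - 1\<close> yields
        the coefficient \<open>m - (i - 1)\<close>; for \<open>i = 0\<close> the term is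
        \<open>e v = 0\<close>.\<close>
      have "m - i + 1 = m - (i - 1)" if "i \<noteq> 0" using \<open>i \<le> m\<close> that by simp
      then show ?thesis
        using that by (cases i) (simp_all add: a_ef fu bu eu l u0[symmetric] v(3)[folded u0] of_nat_diff
            del: of_nat_Suc)
    qed
  qed
qed

end


section \<open>Modules over presented algebras\<close>

text \<open>A word with a coefficient is a product of generators and a constant. Properties of the
  action that survive sums and products can thus be checked on generators.\<close>

lemma free_algebra_induct [case_names const gen add mult]:
  fixes p :: "'g free_algebra"
  assumes "\<And>c. P (fconst c)" and "\<And>g. P (fgen g)"
    and "\<And>p q. \<lbrakk>P p; P q\<rbrakk> \<Longrightarrow> P (p + q)" and "\<And>p q. \<lbrakk>P p; P q\<rbrakk> \<Longrightarrow> P (p * q)"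
  shows "P p"
proof (induction p rule: poly_mapping_single_induct)
  case (single w c)
  have "P (Poly_Mapping.single (Word l) c)" for l :: "'g list"
  proof (induction l)
    case Nil
    show ?case using assms(1)[of c] by (simp add: fconst_def zero_word_def)
  next
    case (Cons g l)
    have "Poly_Mapping.single (Word (g # l)) c = fgen g * Poly_Mapping.single (Word l) c"
      by (simp add: fgen_def mult_single plus_word_def)
    then show ?case using assms(2,4) Cons by simp
  qed
  then show ?case by (cases w) simp
qed (rule assms(3))

lemma presented_act_simps:
  assumes "calg_module scl (presented_algebra R) V act" and v: "v \<in> V"
  shows "act (pres_coset R p) v \<in> V"
    and "act (pres_coset R (p + q)) v = act (pres_coset R p) v + act (pres_coset R q) v"
    and "act (pres_coset R (p - q)) v = act (pres_coset R p) v - act (pres_coset R q) v"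
    and "act (pres_coset R (p * q)) v = act (pres_coset R p) (act (pres_coset R q) v)"
    and "act (pres_coset R (fconst c)) v = scl c v"
proof -
  interpret calg_module scl "presented_algebra R" V act by fact
  have c: "pres_coset R p \<in> carrier (presented_algebra R)" for p by (simp add: pres_carrier)
  show "act (pres_coset R p) v \<in> V" by (rule act_closed[OF c v])
  show add: "act (pres_coset R (p + q)) v = act (pres_coset R p) v + act (pres_coset R q) v" for p q
    using add_act[OF c c v] by (simp add: pres_ops)
  show "act (pres_coset R (p * q)) v = act (pres_coset R p) (act (pres_coset R q) v)"
    using mult_act[OF c c v] by (simp add: pres_ops)
  show "act (pres_coset R (p - q)) v = act (pres_coset R p) v - act (pres_coset R q) v"
    using add[of "p - q" q] by simp
  show "act (pres_coset R (fconst c)) v = scl c v"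
    using cscale_act[OF c v, of c 1] one_act[OF v] by (simp add: pres_ops)
qed

text \<open>The elements of the free algebra preserving \<open>W\<close> include the constants and
  are closed under sums and products, so generators suffice.\<close>

lemma presented_submodule:
  assumes "calg_module scl (presented_algebra R) V act"
    and W: "module.subspace scl W" "W \<subseteq> V"
    and gen: "\<And>g w. w \<in> W \<Longrightarrow> act (pres_gen R g) w \<in> W"
  shows "calg_module.submodule scl (presented_algebra R) V act W"
proof -
  interpret calg_module scl "presented_algebra R" V act by fact
  note simps = presented_act_simps[OF assms(1)]
  have "\<forall>w\<in>W. act (pres_coset R p) w \<in> W" for p
  proof (induction p rule: free_algebra_induct)
    case (gen g)
    then show ?case using assms(4) by (simp add: pres_gen_def)
  qed (use W in \<open>auto simp: simps subsetD[OF W(2)] subspace_scale subspace_add\<close>)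
  then show ?thesis using W by (auto simp: submodule_def pres_carrier)
qed

text \<open>The same reduction to generators, for elements whose action commutes with
  \<open>f\<close>.\<close>

lemma presented_intertwiner:
  assumes V: "calg_module scl (presented_algebra R) V act"
    and W: "calg_module scl' (presented_algebra R) W act'"
    and f: "\<And>v. v \<in> V \<Longrightarrow> f v \<in> W" "\<And>v w. \<lbrakk>v \<in> V; w \<in> V\<rbrakk> \<Longrightarrow> f (v + w) = f v + f w"
      "\<And>c v. v \<in> V \<Longrightarrow> f (scl c v) = scl' c (f v)"
    and gen: "\<And>g v. v \<in> V \<Longrightarrow> f (act (pres_gen R g) v) = act' (pres_gen R g) (f v)"
    and x: "x \<in> carrier (presented_algebra R)" and v: "v \<in> V"
  shows "f (act x v) = act' x (f v)"
proof -
  note simps = presented_act_simps[OF V] presented_act_simps[OF W] f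
  have "\<forall>v\<in>V. f (act (pres_coset R p) v) = act' (pres_coset R p) (f v)" for p
  proof (induction p rule: free_algebra_induct)
    case (gen g)
    then show ?case using assms(6) by (simp add: pres_gen_def)
  qed (simp_all add: simps)
  then show ?thesis using x v by (auto simp: pres_carrier)
qed

section \<open>Schur's lemma and transport of modules\<close>

text \<open>Kernel and image of \<open>f\<close> are submodules; \<open>v0\<close> excludes that the
  kernel is \<open>V\<close> or the image is \<open>{0}\<close>.\<close>

lemma schur:
  assumes V: "calg_module scl A V act" "calg_module.irreducible_module scl A V act"
    and W: "calg_module scl' A W act'" "calg_module.irreducible_module scl' A W act'"
    and fW: "\<And>v. v \<in> V \<Longrightarrow> f v \<in> W"
    and add: "\<And>v w. \<lbrakk>v \<in> V; w \<in> V\<rbrakk> \<Longrightarrow> f (v + w) = f v + f w"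
    and scl: "\<And>c v. v \<in> V \<Longrightarrow> f (scl c v) = scl' c (f v)"
    and act: "\<And>x v. \<lbrakk>x \<in> carrier A; v \<in> V\<rbrakk> \<Longrightarrow> f (act x v) = act' x (f v)"
    and "v0 \<in> V" "f v0 \<noteq> 0"
  shows "module_iso A scl V act scl' W act' f"
proof -
  interpret V: calg_module scl A V act by fact
  interpret W: calg_module scl' A W act' by fact
  have a0: "act' x 0 = 0" if "x \<in> carrier A" for x
    using W.act_scl[OF that, of 0 0] W.subspace_0[OF W.subspace_V] by simp
  have f0: "f 0 = 0" using scl[of 0 0] V.subspace_0[OF V.subspace_V] by simp
  have "V.submodule {v \<in> V. f v = 0}"
    using V.subspace_V
    by (auto simp: V.submodule_def V.subspace_def add scl act a0 f0 V.act_closed)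
  then have ker: "{v \<in> V. f v = 0} = {0}"
    using V(2) \<open>v0 \<in> V\<close> \<open>f v0 \<noteq> 0\<close> unfolding V.irreducible_module_def by blast
  have "inj_on f V"
  proof (rule inj_onI)
    fix x y assume xy: "x \<in> V" "y \<in> V" "f x = f y"
    then have d: "x - y \<in> V" by (simp add: V.subspace_diff[OF V.subspace_V])
    then have "f (x - y) = 0" using add[OF d xy(2)] xy(3) by simp
    with d have "x - y \<in> {v \<in> V. f v = 0}" by simp
    then show "x = y" unfolding ker by simp
  qed
  moreover have "W.submodule (f ` V)"
  proof -
    have "0 \<in> f ` V" using f0 V.subspace_0[OF V.subspace_V] by force
    moreover have "f v + f w \<in> f ` V" if "v \<in> V" "w \<in> V" for v w
      using that V.subspace_add[OF V.subspace_V] by (simp flip: add)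
    moreover have "scl' c (f v) \<in> f ` V" if "v \<in> V" for v c
      using that V.subspace_scale[OF V.subspace_V] by (simp flip: scl)
    moreover have "act' x (f v) \<in> f ` V" if "v \<in> V" "x \<in> carrier A" for v x
      using that by (simp add: V.act_closed flip: act)
    ultimately show ?thesis using fW by (auto simp: W.submodule_def W.subspace_def)
  qed
  then have "f ` V = W"
    using W(2) \<open>v0 \<in> V\<close> \<open>f v0 \<noteq> 0\<close> unfolding W.irreducible_module_def by blast
  ultimately show ?thesis by (simp add: module_iso_def bij_betw_def add scl act)
qed

text \<open>Intertwiners are built below as maps out of \<open>L_space m\<close>, but the
  classification asks for isomorphisms onto it.\<close>

lemma module_iso_inv:
  assumes V: "calg_module scl A V act" and f: "module_iso A scl V act scl' W act' f"
  shows "module_iso A scl' W act' scl V act (inv_into V f)"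
proof -
  interpret V: calg_module scl A V act by fact
  have bij: "bij_betw f V W" using f by (simp add: module_iso_def)
  let ?g = "inv_into V f"
  have W: "W = f ` V" using bij by (simp add: bij_betw_def)
  have g: "?g (f v) = v" if "v \<in> V" for v
    using bij_betw_inv_into_left[OF bij that] .
  have "f v + f w = f (v + w)" "scl' c (f v) = f (scl c v)" if "v \<in> V" "w \<in> V" for v w c
    using f that by (auto simp: module_iso_def)
  moreover have "act' x (f v) = f (act x v)" if "x \<in> carrier A" "v \<in> V" for x v
    using f that by (auto simp: module_iso_def)
  ultimately have "(\<forall>v\<in>W. \<forall>w\<in>W. ?g (v + w) = ?g v + ?g w) \<and> (\<forall>c. \<forall>v\<in>W. ?g (scl' c v) = scl c (?g v))
      \<and> (\<forall>x\<in>carrier A. \<forall>v\<in>W. ?g (act' x v) = act x (?g v))"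
    by (simp add: W g V.subspace_add[OF V.subspace_V] V.subspace_scale[OF V.subspace_V] V.act_closed)
  then show ?thesis using bij_betw_inv_into[OF bij] by (simp add: module_iso_def)
qed

lemma calg_module_pullback:
  assumes f: "f \<in> calg_hom A B" and V: "calg_module scl B V act"
  shows "calg_module scl A V (\<lambda>x. act (f x))"
proof -
  interpret calg_module scl B V act by fact
  have h: "f x \<in> carrier B" "f (x \<oplus>\<^bsub>A\<^esub> y) = f x \<oplus>\<^bsub>B\<^esub> f y" "f (x \<otimes>\<^bsub>A\<^esub> y) = f x \<otimes>\<^bsub>B\<^esub> f y"
    "f (c \<odot>\<^bsub>A\<^esub> x) = c \<odot>\<^bsub>B\<^esub> f x" if "x \<in> carrier A" "y \<in> carrier A" for x y c
    using f that by (auto simp: calg_hom_def ring_hom_def)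
  have "f \<one>\<^bsub>A\<^esub> = \<one>\<^bsub>B\<^esub>" using f by (simp add: calg_hom_def ring_hom_def)
  then show ?thesis
    by unfold_locales
      (simp_all add: subspace_V h act_closed act_add act_scl add_act cscale_act mult_act one_act)
qed

text \<open>A defining relation has the coset of \<open>0\<close>, so it acts by zero and gives an
  identity between the two operators. Subspaces invariant under both are submodules by
  \<open>presented_submodule\<close>, so irreducibility carries over.\<close>

lemma K_rep_module:
  assumes "fd_irr_module (K_alg \<omega>) scl V act"
  shows "K_rep scl V \<omega> (act (K_A \<omega>)) (act (K_B \<omega>))"
    and "K_rep.irreducible scl V (act (K_A \<omega>)) (act (K_B \<omega>))"
proof -
  let ?R = "K_rels \<omega>"
  have m: "calg_module scl (presented_algebra ?R) V act"
    using assms by (simp add: fd_irr_module_def K_alg_def)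
  interpret calg_module scl "presented_algebra ?R" V act by fact
  interpret fd_subspace scl V
    by unfold_locales (use assms in \<open>auto simp: fd_irr_module_def finite_dimensional_module_def\<close>)
  note simps = presented_act_simps[OF m]
  have num: "act (pres_coset ?R (numeral k)) v = scl (numeral k) v" if "v \<in> V" for k v
    using simps(5)[OF that, of "numeral k"] by (simp add: fconst_simps)
  have rel: "act (pres_coset ?R r) v = 0" if "r \<in> ?R" "v \<in> V" for r v
  proof -
    have "pres_coset ?R r = pres_coset ?R 0"
      using rels_subset that(1) by (auto simp: pres_coset_eq_iff)
    then show ?thesis using simps(3)[OF that(2), of 0 0] by simp
  qed
  have endo: "endo (act (pres_coset ?R p))" for p
    by (auto simp: endo_def pres_carrier act_closed act_add act_scl)
  show K: "K_rep scl V \<omega> (act (K_A \<omega>)) (act (K_B \<omega>))"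
  proof
    show "endo (act (K_A \<omega>))" "endo (act (K_B \<omega>))" by (simp_all add: pres_gen_def endo)
    fix v assume v: "v \<in> V"
    have "act (pres_coset ?R (((fgen gA)^2 * fgen gB - 2 * fgen gA * fgen gB * fgen gA
        + fgen gB * (fgen gA)^2) - (fgen gB + fconst \<omega> * fgen gA))) v = 0"
      by (rule rel[OF _ v]) (simp add: K_rels_def Let_def)
    then show "act (K_A \<omega>) (act (K_A \<omega>) (act (K_B \<omega>) v)) - scl 2 (act (K_A \<omega>) (act (K_B \<omega>) (act (K_A \<omega>) v)))
        + act (K_B \<omega>) (act (K_A \<omega>) (act (K_A \<omega>) v)) = act (K_B \<omega>) v + scl \<omega> (act (K_A \<omega>) v)"
      by (simp add: simps num v power2_eq_square pres_gen_def)
    have "act (pres_coset ?R (((fgen gB)^2 * fgen gA - 2 * fgen gB * fgen gA * fgen gB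
        + fgen gA * (fgen gB)^2) - (fgen gA + fconst \<omega> * fgen gB))) v = 0"
      by (rule rel[OF _ v]) (simp add: K_rels_def Let_def)
    then show "act (K_B \<omega>) (act (K_B \<omega>) (act (K_A \<omega>) v)) - scl 2 (act (K_B \<omega>) (act (K_A \<omega>) (act (K_B \<omega>) v)))
        + act (K_A \<omega>) (act (K_B \<omega>) (act (K_B \<omega>) v)) = act (K_A \<omega>) v + scl \<omega> (act (K_B \<omega>) v)"
      by (simp add: simps num v power2_eq_square pres_gen_def)
  qed
  interpret K_rep scl V \<omega> "act (K_A \<omega>)" "act (K_B \<omega>)" by (rule K)
  have "submodule W" if "invariant W" for W
  proof (rule presented_submodule[OF m])
    show "act (pres_gen ?R g) x \<in> W" if "x \<in> W" for g x
      using \<open>invariant W\<close> that by (cases g) (auto simp: invariant_def)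
  qed (use that in \<open>auto simp: invariant_def\<close>)
  then show irreducible
    using assms by (auto simp: irreducible_def fd_irr_module_def irreducible_module_def K_alg_def)
qed

section \<open>The modules \<open>L\<^sub>n\<close> and the classification\<close>

lemma lookup_sum_Lvec:
  "finite S \<Longrightarrow> Poly_Mapping.lookup (\<Sum>i\<in>S. Lscale (c i) (Lvec i)) j = (if j \<in> S then c j else 0)"
  by (simp add: lookup_sum lookup_Lvec if_distrib[of "(*) _"] cong: if_cong)

lemma L_space_iff: "v \<in> L_space n \<longleftrightarrow> (\<forall>i>n. Poly_Mapping.lookup v i = 0)"
proof
  show "\<forall>i>n. Poly_Mapping.lookup v i = 0" if "v \<in> L_space n"
    using that unfolding L_space_def
    by (induction rule: Lvs.span_induct_alt) (auto simp: lookup_add lookup_Lvec)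
next
  assume v: "\<forall>i>n. Poly_Mapping.lookup v i = 0"
  have "v = (\<Sum>i\<le>n. Lscale (Poly_Mapping.lookup v i) (Lvec i))"
    using v by (intro poly_mapping_eqI) (auto simp: lookup_sum_Lvec not_le)
  also have "\<dots> \<in> L_space n"
    unfolding L_space_def by (intro Lvs.span_sum Lvs.span_scale Lvs.span_base) auto
  finally show "v \<in> L_space n" .
qed

lemma Lvec_independent: "Lvs.independent (Lvec ` {0..n})"
proof (rule Lvs.independent_if_scalars_zero)
  have inj: "inj_on Lvec {0..n}" by (rule inj_onI) (metis lookup_Lvec zero_neq_one)
  fix f x assume s: "(\<Sum>x\<in>Lvec ` {0..n}. Lscale (f x) x) = 0" and "x \<in> Lvec ` {0..n}"
  then obtain i where i: "i \<le> n" "x = Lvec i" by auto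
  have "Poly_Mapping.lookup (\<Sum>j\<in>{0..n}. Lscale (f (Lvec j)) (Lvec j)) i = 0"
    using s by (simp add: sum.reindex[OF inj])
  then show "f x = 0" using i by (simp add: lookup_sum_Lvec)
qed simp

lemma dim_L_space: "Lvs.dim (L_space n) = n + 1"
proof -
  have "inj_on Lvec {0..n}" by (rule inj_onI) (metis lookup_Lvec zero_neq_one)
  then show ?thesis
    using Lvs.dim_span_eq_card_independent[OF Lvec_independent[of n]]
    by (simp add: L_space_def card_image)
qed

section \<open>Irreducibility of \<open>L_space n\<close>\<close>

lemma LK_act_gens:
  "LK_act \<omega> n (K_A \<omega>) v =
    Lscale ((1 + \<omega>) / 2) (L_op n gE v) + Lscale ((1 - \<omega>) / 2) (L_op n gF v) - Lscale (\<omega> / 2) (L_op n gH v)"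
  "LK_act \<omega> n (K_B \<omega>) v = Lscale (1 / 2) (L_op n gH v)"
  by (simp_all add: LK_act_def pres_gen_def zeta_pres_coset free_subst_simps L_act_pres_coset Lev.ev_simps)

lemma calg_module_LK: "calg_module Lscale (K_alg \<omega>) (L_space n) (LK_act \<omega> n)"
  using calg_module_pullback[OF zeta_hom calg_module_L] by (simp add: LK_act_def[abs_def])

text \<open>Coordinate \<open>j\<close> of the image comes only from index \<open>Suc j\<close>,
  with factor \<open>n - Suc j + 1 = n - j\<close>. It is nonzero for \<open>j < n\<close>, which
  lets \<open>E\<close> move a leading coefficient down.\<close>

lemma lookup_L_op_gE:
  "Poly_Mapping.lookup (L_op n gE v) j = (if j < n then of_nat (n - j) * Poly_Mapping.lookup v (Suc j) else 0)"
proof -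
  have "Poly_Mapping.lookup (L_basis_op n gE i) j = (if i = Suc j then if j < n then of_nat (n - j) else 0 else 0)"
    for i
    by (auto simp: lookup_Lvec Suc_diff_Suc)
  then show ?thesis
    by (simp add: L_op_def lookup_sum in_keys_iff if_distrib[of "(*) _"] del: L_basis_op.simps cong: if_cong)
qed

text \<open>Repeated use of \<open>E\<close> reaches a multiple of \<open>Lvec 0\<close> from any
  nonzero vector, and repeated use of \<open>F\<close> leads from there to every
  \<open>Lvec i\<close>.\<close>

lemma L_submodule:
  assumes W: "Lvs.subspace W" "W \<subseteq> L_space n" "W \<noteq> {0}"
    and E: "\<And>x. x \<in> W \<Longrightarrow> L_op n gE x \<in> W" and F: "\<And>x. x \<in> W \<Longrightarrow> L_op n gF x \<in> W"
  shows "W = L_space n"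
proof -
  \<comment> \<open>The raising operator \<open>E\<close> lowers the largest index in the support without killing that coefficient.\<close>
  have lower: "Lvec 0 \<in> W"
    if "x \<in> W" "x \<noteq> 0" "k \<le> n" "\<forall>i>k. Poly_Mapping.lookup x i = 0" for x k
    using that
  proof (induction k arbitrary: x)
    case 0
    then have x: "x = Lscale (Poly_Mapping.lookup x 0) (Lvec 0)"
      by (intro poly_mapping_eqI) (auto simp: lookup_Lvec)
    then have "Poly_Mapping.lookup x 0 \<noteq> 0" using 0(2) by auto
    then have "Lvec 0 = Lscale (1 / Poly_Mapping.lookup x 0) x"
      by (subst x) simp
    then show ?case using Lvs.subspace_scale[OF W(1) 0(1)] by metis
  next
    case (Suc k)
    show ?case
    proof (cases "Poly_Mapping.lookup x (Suc k) = 0")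
      case True
      have "\<forall>i>k. Poly_Mapping.lookup x i = 0"
        using Suc.prems(4) True by (metis Suc_lessI)
      then show ?thesis using Suc by simp
    next
      case False
      then have "Poly_Mapping.lookup (L_op n gE x) k \<noteq> 0"
        using Suc.prems(3) by (simp add: lookup_L_op_gE)
      then have "L_op n gE x \<noteq> 0" by auto
      then show ?thesis
        using Suc.IH[OF E[OF Suc.prems(1)]] Suc.prems by (simp add: lookup_L_op_gE)
    qed
  qed
  obtain x where "x \<in> W" "x \<noteq> 0" using W(1,3) Lvs.subspace_0 by blast
  then have "Lvec 0 \<in> W" using lower[of x n] W(2) by (auto simp: L_space_iff)
  then have "Lvec i \<in> W" if "i \<le> n" for i
    using that
  proof (induction i)
    case (Suc i)
    then have "Lscale (1 / of_nat (Suc i)) (L_op n gF (Lvec i)) \<in> W"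
      by (intro Lvs.subspace_scale[OF W(1)] F) simp
    then show ?case using Suc.prems by (simp add: L_op_Lvec del: of_nat_Suc)
  qed
  then have "L_space n \<subseteq> W"
    unfolding L_space_def by (intro Lvs.span_minimal W(1)) auto
  then show ?thesis using W(2) by blast
qed

text \<open>As \<open>1 + \<omega>\<close> and \<open>1 - \<omega>\<close> are invertible,
  \<open>E\<close> and \<open>F\<close> can be expressed through the actions of \<open>A\<close> and
  \<open>B\<close>. A submodule over \<open>K_alg \<omega>\<close> is therefore stable under both,
  and \<open>L_submodule\<close> applies.\<close>

lemma fd_irr_LK:
  assumes "\<omega>\<^sup>2 \<noteq> 1"
  shows "fd_irr_module (K_alg \<omega>) Lscale (L_space n) (LK_act \<omega> n)"
proof -
  interpret calg_module Lscale "K_alg \<omega>" "L_space n" "LK_act \<omega> n" by (rule calg_module_LK)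
  have w: "1 + \<omega> \<noteq> 0" "1 - \<omega> \<noteq> 0" using assms by (auto simp: add_eq_0_iff)
  let ?a = "LK_act \<omega> n (K_A \<omega>)" and ?b = "LK_act \<omega> n (K_B \<omega>)"
  let ?E = "L_op n gE" and ?F = "L_op n gF" and ?H = "L_op n gH"
  have gens: "K_A \<omega> \<in> carrier (K_alg \<omega>)" "K_B \<omega> \<in> carrier (K_alg \<omega>)"
    by (auto simp: K_alg_def pres_carrier pres_gen_def)
  have "free_act Lscale (L_op n) (fgen gH * fgen gE - fgen gE * fgen gH - 2 * fgen gE) x = 0"
    and "free_act Lscale (L_op n) (fgen gH * fgen gF - fgen gF * fgen gH + 2 * fgen gF) x = 0" for x
    by (rule L_rels; simp add: sl2_rels_def Let_def)+
  then have HE: "?H (?E x) = ?E (?H x) + Lscale 2 (?E x)" and HF: "?H (?F x) = ?F (?H x) - Lscale 2 (?F x)" for x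
    by (simp_all add: Lev.ev_simps algebra_simps)
  have d: "L_op n g (x - y) = L_op n g x - L_op n g y" for g x y
    using L_op_add[of n g "x - y" y] by (simp add: algebra_simps)
  \<comment> \<open>With \<open>b = H / 2\<close>, the brackets with \<open>H\<close> give
    \<open>[a, b] = (1 - \<omega>)/2 F - (1 + \<omega>)/2 E\<close>, while
    \<open>a + \<omega> b = (1 + \<omega>)/2 E + (1 - \<omega>)/2 F\<close>.\<close>
  have E: "Lscale (1 + \<omega>) (?E x) = ?a x + Lscale \<omega> (?b x) - (?a (?b x) - ?b (?a x))"
    and F: "Lscale (1 - \<omega>) (?F x) = ?a x + Lscale \<omega> (?b x) + (?a (?b x) - ?b (?a x))" for x
    by (rule poly_mapping_eqI;
        simp add: LK_act_gens L_op_add L_op_scale d HE HF lookup_add lookup_minus field_simps)+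
  have "W = L_space n" if W: "submodule W" "W \<noteq> {0}" for W
  proof (rule L_submodule)
    show sub: "Lvs.subspace W" "W \<subseteq> L_space n" using W(1) by (auto simp: submodule_def)
    have ab: "?a x \<in> W" "?b x \<in> W" if "x \<in> W" for x
      using W(1) gens that by (auto simp: submodule_def)
    note cl = Lvs.subspace_add[OF sub(1)] Lvs.subspace_diff[OF sub(1)] Lvs.subspace_scale[OF sub(1)] ab
    show "?E x \<in> W" if "x \<in> W" for x
    proof -
      have "Lscale (1 + \<omega>) (?E x) \<in> W" unfolding E by (intro cl that)
      then show ?thesis using cl(3)[of "Lscale (1 + \<omega>) (?E x)" "1 / (1 + \<omega>)"] w(1) by simp
    qed
    show "?F x \<in> W" if "x \<in> W" for x
    proof -
      have "Lscale (1 - \<omega>) (?F x) \<in> W" unfolding F by (intro cl that)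
      then show ?thesis using cl(3)[of "Lscale (1 - \<omega>) (?F x)" "1 / (1 - \<omega>)"] w(2) by simp
    qed
  qed fact
  moreover have "L_space n \<noteq> {0}"
  proof -
    have "Lvec 0 \<in> L_space n" "Lvec 0 \<noteq> 0"
      by (auto simp: L_space_iff lookup_Lvec) (metis lookup_Lvec lookup_zero zero_neq_one)
    then show ?thesis by blast
  qed
  ultimately have irreducible_module by (auto simp: irreducible_module_def)
  moreover have finite_dimensional_module
    unfolding finite_dimensional_module_def
    by (intro exI[of _ "Lvec ` {0..n}"]) (auto simp: L_space_iff lookup_Lvec L_space_def[symmetric])
  ultimately show ?thesis using calg_module_LK by (simp add: fd_irr_module_def)
qed

section \<open>Classification of the irreducible modules\<close>

text \<open>The vectors of \<open>highest_weight_basis\<close> define a nonzero intertwiner from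
  \<open>L_space m\<close>, an isomorphism by \<open>schur\<close>. The number \<open>m\<close> is
  produced by the module; the dimension formula identifies it afterwards.\<close>

lemma K_module_iso_L:
  assumes w: "\<omega>\<^sup>2 \<noteq> 1" and irr: "fd_irr_module (K_alg \<omega>) scl V act"
  obtains m f where "module_iso (K_alg \<omega>) scl V act Lscale (L_space m) (LK_act \<omega> m) f"
    "vector_space.dim scl V = m + 1"
proof -
  let ?a = "act (K_A \<omega>)" and ?b = "act (K_B \<omega>)"
  interpret calg_module scl "K_alg \<omega>" V act using irr by (simp add: fd_irr_module_def)
  interpret K_rep scl V \<omega> ?a ?b by (rule K_rep_module(1)[OF irr])
  have "V \<noteq> {0}" using K_rep_module(2)[OF irr] by (simp add: irreducible_def)
  obtain m u where uV: "\<And>i. u i \<in> V" and u0: "u 0 \<noteq> 0" and um: "u (Suc m) = 0"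
    and bu: "\<And>i. i \<le> m \<Longrightarrow> ?b (u i) = scl (of_nat m / 2 - of_nat i) (u i)"
    and au: "\<And>i. i \<le> m \<Longrightarrow> ?a (u i) =
       scl ((1 + \<omega>) / 2) (if i = 0 then 0 else scl (of_nat (m - i + 1)) (u (i - 1)))
       + scl ((1 - \<omega>) / 2 * of_nat (i + 1)) (u (i + 1)) - scl (\<omega> * (of_nat m / 2 - of_nat i)) (u i)"
    by (rule highest_weight_basis[OF w \<open>V \<noteq> {0}\<close>]) (rule that; assumption)
  \<comment> \<open>Ignoring the coordinates beyond \<open>m\<close> makes \<open>g\<close> linear
    on the whole ambient space.\<close>
  define g where "g x = (\<Sum>i\<le>m. scl (Poly_Mapping.lookup x i) (u i))" for x
  interpret g: Vector_Spaces.linear Lscale scl g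
    by unfold_locales (simp_all add: g_def lookup_add scale_left_distrib sum.distrib scale_sum_right)
  have gV: "g x \<in> V" for x
    unfolding g_def by (intro subspace_sum subspace_V V_closed uV)
  have gL: "g (Lvec i) = (if i \<le> m then u i else 0)" for i
    by (simp add: g_def lookup_Lvec if_distrib[of "\<lambda>c. scl c _"] cong: if_cong)
  let ?La = "LK_act \<omega> m (K_A \<omega>)" and ?Lb = "LK_act \<omega> m (K_B \<omega>)"
  have gens: "g (?La x) = ?a (g x) \<and> g (?Lb x) = ?b (g x)" if "x \<in> L_space m" for x
    using that unfolding L_space_def
  proof (induction rule: Lvs.span_induct_alt)
    case base
    have "L_op m h 0 = 0" for h using L_op_scale[of m h 0 0] by simp
    then show ?case by (simp add: LK_act_gens abc_simps g.zero)
  next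
    case (step c x y)
    then obtain i where i: "i \<le> m" "x = Lvec i" by auto
    have gE: "g (L_op m gE (Lvec i)) = (if i = 0 then 0 else scl (of_nat (m - i + 1)) (u (i - 1)))"
      using i(1) by (auto simp: L_op_Lvec g.scale gL simp del: of_nat_add)
    \<comment> \<open>At \<open>i = m\<close> the left side is \<open>0\<close> because
      \<open>F\<close> kills \<open>Lvec m\<close>, the right side because
      \<open>u (Suc m) = 0\<close>.\<close>
    have gF: "g (L_op m gF (Lvec i)) = scl (of_nat (i + 1)) (u (i + 1))"
      using i(1) um by (cases "i = m") (simp_all add: L_op_Lvec g.scale gL)
    have gH: "g (L_op m gH (Lvec i)) = scl (of_nat m - 2 * of_nat i) (u i)"
      using i(1) by (simp add: L_op_Lvec g.scale gL)
    have "\<omega> / 2 * (of_nat m - 2 * of_nat i) = \<omega> * (of_nat m / 2 - of_nat i)"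
      by (simp add: field_simps)
    then have "g (?La (Lvec i)) = ?a (u i)"
      unfolding au[OF i(1)] LK_act_gens g.add g.diff g.scale gE gF gH by simp
    moreover have "g (?Lb (Lvec i)) = ?b (u i)"
      using i(1) by (simp add: bu LK_act_gens L_op_Lvec g.scale gL diff_divide_distrib)
    moreover have "LK_act \<omega> m X (Lscale c x + y) = Lscale c (LK_act \<omega> m X x) + LK_act \<omega> m X y"
      if "X = K_A \<omega> \<or> X = K_B \<omega>" for X
      using that by (auto simp: LK_act_gens L_op_add L_op_scale algebra_simps)
    ultimately show ?case using step i by (simp add: g.add g.scale abc_simps gV gL uV)
  qed
  have iso: "module_iso (K_alg \<omega>) Lscale (L_space m) (LK_act \<omega> m) scl V act g"
  proof (rule schur)
    have L: "fd_irr_module (K_alg \<omega>) Lscale (L_space m) (LK_act \<omega> m)" by (rule fd_irr_LK[OF w])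
    show "calg_module Lscale (K_alg \<omega>) (L_space m) (LK_act \<omega> m)"
      "calg_module.irreducible_module Lscale (K_alg \<omega>) (L_space m) (LK_act \<omega> m)"
      "calg_module scl (K_alg \<omega>) V act"
      "calg_module.irreducible_module scl (K_alg \<omega>) V act"
      using L irr by (auto simp: fd_irr_module_def)
    then have m: "calg_module Lscale (presented_algebra (K_rels \<omega>)) (L_space m) (LK_act \<omega> m)"
      "calg_module scl (presented_algebra (K_rels \<omega>)) V act"
      by (simp_all add: K_alg_def)
    show "g (LK_act \<omega> m x v) = act x (g v)" if "x \<in> carrier (K_alg \<omega>)" "v \<in> L_space m" for x v
    proof (rule presented_intertwiner[OF m])
      show "g (LK_act \<omega> m (pres_gen (K_rels \<omega>) h) v) = act (pres_gen (K_rels \<omega>) h) (g v)"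
        if "v \<in> L_space m" for h v
        using gens[OF that] by (cases h) simp_all
    qed (use that in \<open>auto simp: K_alg_def gV g.add g.scale\<close>)
    show "Lvec 0 \<in> L_space m" by (simp add: L_space_iff lookup_Lvec)
    show "g (Lvec 0) \<noteq> 0" using u0 by (simp add: gL)
  qed (auto simp: gV g.add g.scale)
  then have "inj_on g (L_space m)" "g ` L_space m = V"
    by (auto simp: module_iso_def bij_betw_def)
  \<comment> \<open>\<open>g\<close> kills \<open>Lvec i\<close> for \<open>i > m\<close>, so
    injectivity is available only on the span of the first \<open>m + 1\<close> vectors.\<close>
  moreover from this have "independent (g ` Lvec ` {0..m})"
    by (intro g.independent_injective_image Lvec_independent) (simp add: L_space_def)
  ultimately have "dim V = card (g ` Lvec ` {0..m})"
    using dim_span_eq_card_independent[of "g ` Lvec ` {0..m}"] g.span_image[of "Lvec ` {0..m}"]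
    by (simp add: L_space_def)
  also have "\<dots> = card (Lvec ` {0..m})"
    by (rule card_image, rule inj_on_subset[OF \<open>inj_on g (L_space m)\<close>])
      (auto simp: L_space_iff lookup_Lvec)
  also have "\<dots> = m + 1"
    using dim_L_space[of m] Lvs.dim_span_eq_card_independent[OF Lvec_independent[of m]]
    by (simp add: L_space_def)
  finally show thesis
    using that[OF module_iso_inv[OF calg_module_LK iso]] by blast
qed

text \<open>With \<open>s = -\<omega>\<close> the cases \<open>\<omega> = -1\<close> and
  \<open>\<omega> = 1\<close> take one form, in which \<open>B\<close> acts as \<open>s\<close>
  times \<open>A\<close>. For \<open>s = 1\<close> this is \<open>irreducible_solvable\<close>; for
  \<open>s = -1\<close> the same lemma is applied after \<open>minus_b\<close>.\<close>

lemma K_module_scalar: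
  assumes "s = 1 \<or> s = -1" and irr: "fd_irr_module (K_alg (- s)) scl V act"
  shows "vector_space.dim scl V = 1 \<and>
    (\<exists>\<mu>. \<forall>v\<in>V. act (K_A (- s)) v = scl \<mu> v \<and> act (K_B (- s)) v = scl (s * \<mu>) v)"
proof -
  let ?a = "act (K_A (- s))" and ?b = "act (K_B (- s))"
  interpret K_rep scl V "- s" ?a ?b by (rule K_rep_module(1)[OF irr])
  have i: irreducible by (rule K_rep_module(2)[OF irr])
  obtain v l where v: "v \<noteq> 0" "V = span {v}"
    and l: "\<And>x. x \<in> V \<Longrightarrow> ?a x = scl l x \<and> ?b x = scl (s * l) x"
    using assms(1)
  proof
    assume "s = 1"
    then show thesis using irreducible_solvable[OF _ i] that by auto
  next
    assume s: "s = -1"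
    interpret minus: K_rep scl V s ?a "\<lambda>v. - ?b v" using minus_b by simp
    \<comment> \<open>A subspace is stable under an operator exactly when it is stable under its
      negative, so both pairs have the same irreducibility.\<close>
    have "minus.invariant = invariant"
      by (auto simp: fun_eq_iff minus.invariant_def invariant_def)
        (metis minus_minus subspace_neg)+
    then have "minus.irreducible" using i by (simp add: minus.irreducible_def irreducible_def)
    then obtain v l where "v \<noteq> 0" "V = span {v}"
      and l: "\<And>x. x \<in> V \<Longrightarrow> ?a x = scl l x \<and> - ?b x = scl l x"
      using minus.irreducible_solvable[OF s] by blast
    moreover have "?b x = scl (s * l) x" if "x \<in> V" for x
      using l[OF that] s by (metis minus_minus mult_minus1 scale_minus_left)
    ultimately show thesis using that by blast
  qed
  have "dim V = 1" using v dim_span_eq_card_independent[of "{v}"] by simp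
  then show ?thesis using l by blast
qed

theorem theorem2p2:
  fixes \<omega> :: complex
  shows
    "(\<omega> = -1 \<longrightarrow>
       (\<forall>(scl :: complex \<Rightarrow> 'v::ab_group_add \<Rightarrow> 'v) V act.
          fd_irr_module (K_alg \<omega>) scl V act \<longrightarrow>
          vector_space.dim scl V = 1 \<and>
          (\<exists>\<mu>. \<forall>v\<in>V. act (K_A \<omega>) v = scl \<mu> v \<and> act (K_B \<omega>) v = scl \<mu> v)))
     \<and>
     (\<omega> = 1 \<longrightarrow>
       (\<forall>(scl :: complex \<Rightarrow> 'v \<Rightarrow> 'v) V act.
          fd_irr_module (K_alg \<omega>) scl V act \<longrightarrow>
          vector_space.dim scl V = 1 \<and>
          (\<exists>\<mu>. \<forall>v\<in>V. act (K_A \<omega>) v = scl \<mu> v \<and> act (K_B \<omega>) v = scl (- \<mu>) v)))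
     \<and>
     (\<omega>\<^sup>2 \<noteq> 1 \<longrightarrow>
       (\<forall>n::nat.
          fd_irr_module (K_alg \<omega>) Lscale (L_space n) (LK_act \<omega> n) \<and>
          vector_space.dim Lscale (L_space n) = n + 1 \<and>
          (\<forall>(scl :: complex \<Rightarrow> 'v \<Rightarrow> 'v) V act.
             fd_irr_module (K_alg \<omega>) scl V act \<and> vector_space.dim scl V = n + 1 \<longrightarrow>
             (\<exists>f. module_iso (K_alg \<omega>) scl V act Lscale (L_space n) (LK_act \<omega> n) f))))"
proof (intro conjI impI allI; (elim conjE)?)
  fix scl :: "complex \<Rightarrow> 'v \<Rightarrow> 'v" and V act
  assume "\<omega> = -1" "fd_irr_module (K_alg \<omega>) scl V act"
  then show "vector_space.dim scl V = 1"
    and "\<exists>\<mu>. \<forall>v\<in>V. act (K_A \<omega>) v = scl \<mu> v \<and> act (K_B \<omega>) v = scl \<mu> v"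
    using K_module_scalar[of 1 scl V act] by simp_all
next
  fix scl :: "complex \<Rightarrow> 'v \<Rightarrow> 'v" and V act
  assume "\<omega> = 1" "fd_irr_module (K_alg \<omega>) scl V act"
  then show "vector_space.dim scl V = 1"
    and "\<exists>\<mu>. \<forall>v\<in>V. act (K_A \<omega>) v = scl \<mu> v \<and> act (K_B \<omega>) v = scl (- \<mu>) v"
    using K_module_scalar[of "-1" scl V act] by simp_all
next
  fix n :: nat
  assume w: "\<omega>\<^sup>2 \<noteq> 1"
  show "fd_irr_module (K_alg \<omega>) Lscale (L_space n) (LK_act \<omega> n)" by (rule fd_irr_LK[OF w])
  show "vector_space.dim Lscale (L_space n) = n + 1" by (rule dim_L_space)
  fix scl :: "complex \<Rightarrow> 'v \<Rightarrow> 'v" and V act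
  assume irr: "fd_irr_module (K_alg \<omega>) scl V act" and dim: "vector_space.dim scl V = n + 1"
  \<comment> \<open>Comparing dimensions gives \<open>m + 1 = n + 1\<close>, so this
    \<open>m\<close> is \<open>n\<close>.\<close>
  obtain m f where "module_iso (K_alg \<omega>) scl V act Lscale (L_space m) (LK_act \<omega> m) f"
    "vector_space.dim scl V = m + 1"
    using K_module_iso_L[OF w irr] .
  then show "\<exists>f. module_iso (K_alg \<omega>) scl V act Lscale (L_space n) (LK_act \<omega> n) f"
    using dim by auto
qed

end
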